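(* Let $H$ be a connected bipartite graph. Then the following are equivalent: (i) $H$ is real-norming on $\mathcal{F}_{\mathbb{R}}^{\mathrm{sym}}$; (ii) $f\mapsto q_H(f)^{1/e(H)}$ is a norm on $\mathcal{F}_{\mathbb{R}}$; (iii) $H$ is real-norming on $\mathcal{F}_{\mathbb{R}}$. Likewise, the following are equivalent: (i') $H$ is weakly norming on $\mathcal{F}_{\mathbb{R}}^{\mathrm{sym}}$; (ii') $f\mapsto q_H(|f|)^{1/e(H)}$ is a norm on $\mathcal{F}_{\mathbb{R}}$; (iii') $H$ is weakly norming on $\mathcal{F}_{\mathbb{R}}$.
   Context: $\mathcal{F}_{\mathbb{R}}$ is the real vector space of bounded measurable $f:[0,1]^2\to\mathbb{R}$, $\mathcal{F}_{\mathbb{R}}^{\mathrm{sym}}$ its subspace of symmetric functions; a "norm" is a seminorm vanishing only on functions that are $0$ a.e. $H$ is finite, nonempty, without isolated vertices, with fixed bipartition $A\cup B$, edges written $(u,v)$, $u\in A$, $v\in B$; $e(H)=|E(H)|$. With variables $x_u$ ($u\in A$), $y_v$ ($v\in B$) in $[0,1]$ and Lebesgue measure, $t_H(f)=\int\prod_{(u,v)\in E(H)}f(x_u,y_v)$. For $\alpha:E(H)\to\{0,1\}$, $r_{H,\alpha}(f)=\int\prod_{e=(u,v)\in E(H)}f(x_u,y_v)^{\alpha(e)}f(y_v,x_u)^{1-\alpha(e)}$ and $q_H(f)=\max_\alpha|r_{H,\alpha}(f)|$, the maximum over all $\alpha:E(H)\to\{0,1\}$. $H$ is real-norming on a space $\mathcal{S}$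 if $|t_H(\cdot)|^{1/e(H)}$ is a norm on $\mathcal{S}$, and weakly norming on $\mathcal{S}$ if $f\mapsto t_H(|f|)^{1/e(H)}$ is a norm on $\mathcal{S}$. *)

theory Defs
  imports "HOL-Analysis.Analysis"
begin

text \<open>
  A graph \<open>H\<close> with fixed bipartition \<open>A \<union> B\<close> is given by \<open>A\<close>, \<open>B\<close> and the set \<open>E\<close> of its
  edges, each written as the pair \<open>(u, v)\<close> with \<open>u \<in> A\<close> and \<open>v \<in> B\<close>.
\<close>

definition bipartite_graph :: "'v set \<Rightarrow> 'v set \<Rightarrow> ('v \<times> 'v) set \<Rightarrow> bool" where
  "bipartite_graph A B E \<longleftrightarrow>
     finite (A \<union> B) \<and> A \<union> B \<noteq> {} \<and> A \<inter> B = {} \<and> E \<subseteq> A \<times> B"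

definition no_isolated_vertices :: "'v set \<Rightarrow> 'v set \<Rightarrow> ('v \<times> 'v) set \<Rightarrow> bool" where
  "no_isolated_vertices A B E \<longleftrightarrow> (\<forall>w\<in>A \<union> B. \<exists>w'. (w, w') \<in> E \<or> (w', w) \<in> E)"

definition connected_graph :: "'v set \<Rightarrow> 'v set \<Rightarrow> ('v \<times> 'v) set \<Rightarrow> bool" where
  "connected_graph A B E \<longleftrightarrow> (\<forall>w\<in>A \<union> B. \<forall>w'\<in>A \<union> B. (w, w') \<in> (E \<union> E\<inverse>)\<^sup>*)"

text \<open>
  Functions on the unit square are represented by functions on \<^typ>\<open>real \<times> real\<close>; their values
  outside the square are unconstrained and enter none of the notions below.
\<close>

abbreviation unit_square :: "(real \<times> real) set" where
  "unit_square \<equiv> {0..1} \<times> {0..1}"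

definition F_real :: "(real \<times> real \<Rightarrow> real) set" where
  "F_real = {f. f \<in> borel_measurable (lebesgue_on unit_square) \<and> bounded (f ` unit_square)}"

definition F_real_sym :: "(real \<times> real \<Rightarrow> real) set" where
  "F_real_sym = {f \<in> F_real. \<forall>x\<in>{0..1}. \<forall>y\<in>{0..1}. f (x, y) = f (y, x)}"

definition seminorm_on ::
  "(real \<times> real \<Rightarrow> real) set \<Rightarrow> ((real \<times> real \<Rightarrow> real) \<Rightarrow> real) \<Rightarrow> bool" where
  "seminorm_on S N \<longleftrightarrow>
     (\<forall>f\<in>S. 0 \<le> N f) \<and>
     (\<forall>f\<in>S. \<forall>c. N (\<lambda>p. c * f p) = \<bar>c\<bar> * N f) \<and>
     (\<forall>f\<in>S. \<forall>g\<in>S. N (\<lambda>p. f p + g p) \<le> N f + N g)"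

definition norm_on ::
  "(real \<times> real \<Rightarrow> real) set \<Rightarrow> ((real \<times> real \<Rightarrow> real) \<Rightarrow> real) \<Rightarrow> bool" where
  "norm_on S N \<longleftrightarrow>
     seminorm_on S N \<and> (\<forall>f\<in>S. N f = 0 \<longrightarrow> (AE p in lebesgue_on unit_square. f p = 0))"

text \<open>
  Lebesgue measure on the cube \<open>[0,1]\<^bsup>A \<union> B\<^esup>\<close>. A point \<open>z\<close> combines the variables \<open>x\<^sub>u = z u\<close>
  for \<open>u \<in> A\<close> and \<open>y\<^sub>v = z v\<close> for \<open>v \<in> B\<close>. The completion is needed because \<^const>\<open>F_real\<close>
  contains functions that are Lebesgue but not Borel measurable: without it, the integrands
  below need not be measurable, and the Bochner integral would then be \<open>0\<close> by default.
\<close>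

definition cube_measure :: "'v set \<Rightarrow> 'v set \<Rightarrow> ('v \<Rightarrow> real) measure" where
  "cube_measure A B = completion (Pi\<^sub>M (A \<union> B) (\<lambda>_. restrict_space lborel {0..1}))"

definition t_H ::
  "'v set \<Rightarrow> 'v set \<Rightarrow> ('v \<times> 'v) set \<Rightarrow> (real \<times> real \<Rightarrow> real) \<Rightarrow> real" where
  "t_H A B E f = (\<integral>z. (\<Prod>(u, v)\<in>E. f (z u, z v)) \<partial>cube_measure A B)"

definition r_H ::
  "'v set \<Rightarrow> 'v set \<Rightarrow> ('v \<times> 'v) set \<Rightarrow> ('v \<times> 'v \<Rightarrow> nat) \<Rightarrow> (real \<times> real \<Rightarrow> real) \<Rightarrow> real" where
  "r_H A B E \<alpha> f =
     (\<integral>z. (\<Prod>(u, v)\<in>E. f (z u, z v) ^ \<alpha> (u, v) * f (z v, z u) ^ (1 - \<alpha> (u, v)))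
        \<partial>cube_measure A B)"

definition q_H ::
  "'v set \<Rightarrow> 'v set \<Rightarrow> ('v \<times> 'v) set \<Rightarrow> (real \<times> real \<Rightarrow> real) \<Rightarrow> real" where
  "q_H A B E f = Max ((\<lambda>\<alpha>. \<bar>r_H A B E \<alpha> f\<bar>) ` (E \<rightarrow>\<^sub>E {0, 1}))"

definition real_norming ::
  "'v set \<Rightarrow> 'v set \<Rightarrow> ('v \<times> 'v) set \<Rightarrow> (real \<times> real \<Rightarrow> real) set \<Rightarrow> bool" where
  "real_norming A B E S \<longleftrightarrow> norm_on S (\<lambda>f. \<bar>t_H A B E f\<bar> powr (1 / real (card E)))"

definition weakly_norming ::
  "'v set \<Rightarrow> 'v set \<Rightarrow> ('v \<times> 'v) set \<Rightarrow> (real \<times> real \<Rightarrow> real) set \<Rightarrow> bool" where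
  "weakly_norming A B E S \<longleftrightarrow>
     norm_on S (\<lambda>f. t_H A B E (\<lambda>p. \<bar>f p\<bar>) powr (1 / real (card E)))"

end

theory Submission
  imports Defs "HOL-Probability.Independent_Family" "HOL-Probability.Weak_Convergence"
begin

text \<open>
  Splitting the bits of a uniform variable gives a map \<open>[0,1] \<rightarrow> [0,1]\<^sup>2\<close> that pushes Lebesgue
  measure forward to Lebesgue measure, so that tensor products of kernels on \<open>[0,1]\<close> are again
  kernels on \<open>[0,1]\<close>, and all homomorphism densities are multiplicative for them.

  If \<open>\<bar>t\<^sub>H\<bar>\<^bsup>1/e(H)\<^esup>\<close> satisfies the triangle inequality on symmetric functions, applying it to a
  sum of high tensor powers gives a Hoelder inequality for edge-decorated densities. The
  symmetrisation of \<open>f\<close> by an off-diagonal block has density proportional to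
  \<open>t\<^sub>H(f) + t\<^sub>H(f\<^sup>T)\<close> because \<open>H\<close> is connected; inserting tensor powers of \<open>f\<close> there bounds every
  \<open>\<bar>r\<^bsub>H,\<alpha>\<^esub>(f)\<bar>\<close> by \<open>max(\<bar>t\<^sub>H(f)\<bar>, \<bar>t\<^sub>H(f\<^sup>T)\<bar>)\<close>, which is therefore \<open>q\<^sub>H(f)\<close>, and the decorated
  form of this bound is the triangle inequality for its root.

  Conversely \<open>q\<^sub>H\<close> of a single off-diagonal block is proportional to this maximum. If the maximum
  is not always \<open>\<bar>t\<^sub>H\<bar>\<close>, tensoring with high powers of some \<open>h\<close> with
  \<open>\<bar>t\<^sub>H(h)\<bar> > \<bar>t\<^sub>H(h\<^sup>T)\<bar>\<close> isolates \<open>\<bar>t\<^sub>H\<bar>\<close>. Definiteness follows from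
  \<open>t\<^sub>H(f \<otimes> f\<^sup>T) = t\<^sub>H(f) t\<^sub>H(f\<^sup>T)\<close>.
\<close>

section \<open>A measure-preserving map from the interval to the square\<close>

abbreviation unit_measure :: "real measure" where
  "unit_measure \<equiv> restrict_space lborel {0..1}"

lemma prob_space_unit_measure: "prob_space unit_measure"
  by (intro prob_spaceI) (simp add: emeasure_restrict_space space_restrict_space)

section \<open>Binary digits and their interleaving in base four\<close>

definition bdigit :: "real \<Rightarrow> nat \<Rightarrow> int" where
  "bdigit x k = \<lfloor>2 ^ Suc k * x\<rfloor> - 2 * \<lfloor>2 ^ k * x\<rfloor>"

lemma bdigit_cases: "bdigit x k \<in> {0, 1}"
proof -
  have "bdigit x k = 0 \<or> bdigit x k = 1"
    unfolding bdigit_def power_Suc by linarith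
  then show ?thesis by auto
qed

text \<open>The differences of floors telescope, starting from floor 0 because \<open>x < 1\<close>:
  a partial sum is \<open>2 ^ n * x\<close> rounded down and divided by \<open>2 ^ n\<close>, hence
  within \<open>(1 / 2) ^ n\<close> of \<open>x\<close>.\<close>

lemma bdigit_sums:
  assumes "0 \<le> x" "x < 1"
  shows "(\<lambda>k. of_int (bdigit x k) / 2 ^ Suc k) sums x"
proof -
  have partial: "(\<Sum>k<n. real_of_int (bdigit x k) / 2 ^ Suc k) = of_int \<lfloor>2 ^ n * x\<rfloor> / 2 ^ n" for n
  proof (induction n)
    case 0
    have "\<lfloor>x\<rfloor> = 0" using assms by linarith
    then show ?case by simp
  next
    case (Suc n)
    then show ?case by (simp add: bdigit_def field_simps)
  qed
  have "(\<lambda>n. of_int \<lfloor>2 ^ n * x\<rfloor> / 2 ^ n) \<longlonglongrightarrow> x"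
  proof (rule tendsto_sandwich)
    show "(\<lambda>n. x - (1 / 2) ^ n) \<longlonglongrightarrow> x"
      by (rule tendsto_eq_intros LIMSEQ_power_zero refl | simp)+
    show "(\<lambda>n. x) \<longlonglongrightarrow> x" by simp
    show "\<forall>\<^sub>F n in sequentially. x - (1 / 2) ^ n \<le> of_int \<lfloor>2 ^ n * x\<rfloor> / 2 ^ n"
    proof (intro always_eventually allI)
      fix n :: nat
      have "2 ^ n * x - 1 \<le> of_int \<lfloor>2 ^ n * x\<rfloor>" by linarith
      then have "(2 ^ n * x - 1) / 2 ^ n \<le> of_int \<lfloor>2 ^ n * x\<rfloor> / 2 ^ n"
        by (rule divide_right_mono) simp
      then show "x - (1 / 2) ^ n \<le> of_int \<lfloor>2 ^ n * x\<rfloor> / 2 ^ n"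
        by (simp add: diff_divide_distrib power_divide)
    qed
    show "\<forall>\<^sub>F n in sequentially. of_int \<lfloor>2 ^ n * x\<rfloor> / 2 ^ n \<le> x"
    proof (intro always_eventually allI)
      fix n :: nat
      have "of_int \<lfloor>2 ^ n * x\<rfloor> \<le> 2 ^ n * x" by linarith
      then have "of_int \<lfloor>2 ^ n * x\<rfloor> / 2 ^ n \<le> 2 ^ n * x / 2 ^ n"
        by (rule divide_right_mono) simp
      then show "of_int \<lfloor>2 ^ n * x\<rfloor> / 2 ^ n \<le> x" by simp
    qed
  qed
  then show ?thesis
    unfolding sums_def partial .
qed

text \<open>In base four with digits \<open>0\<close> and \<open>1\<close> expansions are unique, so the digits can be read off.\<close>

lemma base4_digit:
  fixes b :: "nat \<Rightarrow> int"
  assumes b: "\<And>n. b n \<in> {0, 1}"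
  defines "c \<equiv> \<Sum>n. of_int (b n) / (4 :: real) ^ Suc n"
  shows "\<lfloor>4 ^ Suc n * c\<rfloor> - 4 * \<lfloor>4 ^ n * c\<rfloor> = b n"
proof -
  define tail where "tail n = (\<Sum>k. of_int (b (k + n)) / (4 :: real) ^ Suc k)" for n
  have geo: "(\<lambda>k. 1 / (4 :: real) ^ Suc k) sums (1 / 3)"
    using sums_mult[OF geometric_sums[of "1 / 4 :: real"], of "1 / 4"]
    by (simp add: power_divide)
  have b01: "0 \<le> real_of_int (b k)" "real_of_int (b k) \<le> 1" for k
    using b[of k] by auto
  have summable: "summable (\<lambda>k. of_int (b (k + n)) / (4 :: real) ^ Suc k)" for n
    by (rule summable_comparison_test[OF _ sums_summable[OF geo]])
       (use b01 in \<open>auto intro!: exI[of _ 0] divide_right_mono\<close>)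
  \<comment> \<open>A tail is at most \<open>1 / 3 < 1\<close>, so it never carries into the integer
    part; in base two a tail of ones would equal 1.\<close>
  have tail: "0 \<le> tail n" "tail n \<le> 1 / 3" for n
  proof -
    show "0 \<le> tail n"
      unfolding tail_def by (rule suminf_nonneg[OF summable]) (use b01 in auto)
    have "tail n \<le> (\<Sum>k. 1 / (4 :: real) ^ Suc k)"
      unfolding tail_def
      by (rule suminf_le[OF _ summable sums_summable[OF geo]]) (use b01 in \<open>auto intro!: divide_right_mono\<close>)
    then show "tail n \<le> 1 / 3" using sums_unique[OF geo] by simp
  qed
  have step: "4 * tail n = of_int (b n) + tail (Suc n)" for n
  proof -
    have "tail n = (\<Sum>k. of_int (b (Suc k + n)) / (4 :: real) ^ Suc (Suc k)) + of_int (b n) / 4"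
      unfolding tail_def using suminf_split_head[OF summable[of n]] by simp
    also have "(\<Sum>k. of_int (b (Suc k + n)) / (4 :: real) ^ Suc (Suc k)) = tail (Suc n) / 4"
      unfolding tail_def using suminf_divide[OF summable[of "Suc n"], of 4]
      by (simp add: mult_ac)
    finally show ?thesis by simp
  qed
  define I where "I = rec_nat (0 :: int) (\<lambda>n i. 4 * i + b n)"
  have I: "4 ^ n * c = of_int (I n) + tail n" for n
  proof (induction n)
    case 0
    then show ?case by (simp add: I_def c_def tail_def)
  next
    case (Suc n)
    have "4 ^ Suc n * c = 4 * of_int (I n) + 4 * tail n"
      using Suc by simp
    then show ?case using step[of n] by (simp add: I_def)
  qed
  have fl: "\<lfloor>4 ^ n * c\<rfloor> = I n" for n
    unfolding I using tail[of n] by linarith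
  show ?thesis
    unfolding fl by (simp add: I_def)
qed

text \<open>Binary digits are rewritten in base four to keep expansions unique, so the coordinates
  can be recovered on all of \<open>[0,1)^2\<close>, dyadic rationals included.\<close>

definition interleave :: "real \<times> real \<Rightarrow> real" where
  "interleave p = (\<Sum>n. of_int (if even n then bdigit (fst p) (n div 2) else bdigit (snd p) (n div 2)) / 4 ^ Suc n)"

definition uninterleave :: "real \<Rightarrow> real \<times> real" where
  "uninterleave c =
     (\<Sum>k. of_int (\<lfloor>4 ^ Suc (2 * k) * c\<rfloor> - 4 * \<lfloor>4 ^ (2 * k) * c\<rfloor>) / 2 ^ Suc k,
      \<Sum>k. of_int (\<lfloor>4 ^ Suc (2 * k + 1) * c\<rfloor> - 4 * \<lfloor>4 ^ (2 * k + 1) * c\<rfloor>) / 2 ^ Suc k)"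

lemma uninterleave_interleave:
  assumes "0 \<le> x" "x < 1" "0 \<le> y" "y < 1"
  shows "uninterleave (interleave (x, y)) = (x, y)"
proof -
  define b where "b n = (if even n then bdigit x (n div 2) else bdigit y (n div 2))" for n
  have b: "b n \<in> {0, 1}" for n
    using bdigit_cases[of x "n div 2"] bdigit_cases[of y "n div 2"] unfolding b_def by presburger
  have c: "interleave (x, y) = (\<Sum>n. of_int (b n) / (4 :: real) ^ Suc n)"
    unfolding interleave_def b_def fst_conv snd_conv ..
  note digit = base4_digit[of b, OF b, folded c]
  have "b (2 * k) = bdigit x k" "b (2 * k + 1) = bdigit y k" for k
    by (simp_all add: b_def)
  then show ?thesis
    using sums_unique[OF bdigit_sums[OF assms(1,2)]] sums_unique[OF bdigit_sums[OF assms(3,4)]]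
    unfolding uninterleave_def digit by simp
qed

lemma measurable_interleave [measurable]: "interleave \<in> borel_measurable borel"
  unfolding interleave_def bdigit_def borel_prod[symmetric]
  by measurable

lemma measurable_uninterleave [measurable]: "uninterleave \<in> borel_measurable borel"
  unfolding uninterleave_def borel_prod[symmetric] by measurable

text \<open>Quantile transform: the generalised inverse \<open>I\<close> of the distribution
  function maps the uniform law on the open interval to \<open>M\<close>. It is extended by 0, and
  the end points are null.\<close>

lemma ex_unit_measure_map:
  assumes "real_distribution M"
  shows "\<exists>q \<in> borel_measurable borel. distr unit_measure borel q = M"
proof -
  interpret cdf_distribution M using assms by (simp add: cdf_distribution_def)
  let ?V = "restrict_space lborel {0<..<1} :: real measure"
  define q where "q x = (if x \<in> {0<..<1} then I x else 0)" for x
  have I: "I \<in> borel_measurable (restrict_space borel {0<..<1})" by (rule measurable_CI)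
  then have "(\<lambda>x. indicat_real {0<..<1} x *\<^sub>R I x) \<in> borel_measurable borel"
    by (subst (asm) borel_measurable_restrict_space_iff) auto
  also have "(\<lambda>x. indicat_real {0<..<1} x *\<^sub>R I x) = q"
    by (auto simp: q_def indicator_def)
  finally have q: "q \<in> borel_measurable borel" .
  then have qU: "q \<in> borel_measurable unit_measure"
    by (simp add: measurable_restrict_space1)
  have "distr unit_measure borel q = distr ?V borel I"
  proof (rule measure_eqI)
    fix X assume "X \<in> sets (distr unit_measure borel q)"
    then have X: "X \<in> sets borel" by simp
    have "emeasure (distr unit_measure borel q) X = emeasure lborel (q -` X \<inter> {0..1})"
      using X qU by (simp add: emeasure_distr emeasure_restrict_space space_restrict_space)
    also have "\<dots> = emeasure lborel (q -` X \<inter> {0<..<1})"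
    proof (rule emeasure_eq_AE)
      have "AE x in lborel. x \<noteq> (0::real)" "AE x in lborel. x \<noteq> (1::real)"
        by (auto intro: AE_lborel_singleton)
      then show "AE x in lborel. x \<in> q -` X \<inter> {0..1} \<longleftrightarrow> x \<in> q -` X \<inter> {0<..<1}"
        by eventually_elim auto
    qed (use q X in \<open>auto intro!: measurable_sets_borel\<close>)
    also have "q -` X \<inter> {0<..<1} = I -` X \<inter> {0<..<1}" by (auto simp: q_def)
    also have "emeasure lborel \<dots> = emeasure (distr ?V borel I) X"
      using X I by (simp add: emeasure_distr emeasure_restrict_space space_restrict_space)
    finally show "emeasure (distr unit_measure borel q) X = emeasure (distr ?V borel I) X" .
  qed simp
  then show ?thesis using distr_I_eq_M q by metis
qed

lemma AE_unit_measure_less: "AE x in unit_measure. 0 \<le> x \<and> x < 1"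
proof -
  have "AE x in lborel. x \<noteq> (1::real)" by (rule AE_lborel_singleton)
  then show ?thesis
    by (subst AE_restrict_space_iff) (auto elim: eventually_mono)
qed

text \<open>A uniform pair is encoded as one real by \<open>interleave\<close>; a quantile map
  samples that law from a uniform variable, and \<open>uninterleave\<close> decodes it almost
  surely.\<close>

lemma ex_unit_square_map:
  "\<exists>q \<in> borel_measurable borel.
     distr unit_measure borel q = distr (unit_measure \<Otimes>\<^sub>M unit_measure) borel (\<lambda>p. p)"
proof -
  let ?UU = "unit_measure \<Otimes>\<^sub>M unit_measure"
  interpret U: prob_space unit_measure by (rule prob_space_unit_measure)
  interpret UU: pair_prob_space unit_measure unit_measure ..
  have *: "(\<lambda>x. x) \<in> borel_measurable unit_measure"
    by (simp add: measurable_restrict_space1)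
  have [measurable]: "fst \<in> borel_measurable ?UU" "snd \<in> borel_measurable ?UU"
    by (rule measurable_compose[OF measurable_fst *], rule measurable_compose[OF measurable_snd *])
  have id: "(\<lambda>p. p) \<in> borel_measurable ?UU"
    using measurable_Pair[of fst ?UU borel snd borel] by (simp add: borel_prod)
  have int: "interleave \<in> borel_measurable ?UU"
    using measurable_compose[OF id measurable_interleave] by simp
  have "real_distribution (distr ?UU borel interleave)"
    unfolding real_distribution_def real_distribution_axioms_def
    using UU.prob_space_distr[OF int] by simp
  from ex_unit_measure_map[OF this] obtain q where
    q: "q \<in> borel_measurable borel" "distr unit_measure borel q = distr ?UU borel interleave"
    by auto
  then have qU: "q \<in> borel_measurable unit_measure"
    by (simp add: measurable_restrict_space1)
  have "distr unit_measure borel (\<lambda>x. uninterleave (q x)) = distr (distr unit_measure borel q) borel uninterleave"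
    using qU by (subst distr_distr) (auto simp: comp_def)
  also have "\<dots> = distr ?UU borel (\<lambda>p. uninterleave (interleave p))"
    unfolding q(2) using int by (subst distr_distr) (auto simp: comp_def)
  also have "\<dots> = distr ?UU borel (\<lambda>p. p)"
  proof (rule distr_cong_AE)
    have "AE p in ?UU. (0 \<le> fst p \<and> fst p < 1) \<and> (0 \<le> snd p \<and> snd p < 1)"
    proof (rule UU.AE_pair_measure)
      show "AE x in unit_measure. AE y in unit_measure.
          (0 \<le> fst (x, y) \<and> fst (x, y) < 1) \<and> (0 \<le> snd (x, y) \<and> snd (x, y) < 1)"
        using AE_unit_measure_less
      proof eventually_elim
        case (elim x)
        show ?case using AE_unit_measure_less by eventually_elim (use elim in simp)
      qed
    qed measurable
    then show "AE p in ?UU. uninterleave (interleave p) = p"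
      by eventually_elim (auto simp: uninterleave_interleave split: prod.splits)
  qed (use id int in auto)
  finally show ?thesis
    using q(1) by (intro bexI[of _ "\<lambda>x. uninterleave (q x)"]) auto
qed

section \<open>Laws of a uniform variable and of a uniform pair\<close>

lemma fst_snd_borel_measurable [measurable]:
  "fst \<in> borel_measurable (borel :: (real \<times> real) measure)"
  "snd \<in> borel_measurable (borel :: (real \<times> real) measure)"
  by (simp_all add: borel_prod[symmetric])

abbreviation square_law :: "(real \<times> real) measure" where
  "square_law \<equiv> distr (unit_measure \<Otimes>\<^sub>M unit_measure) borel (\<lambda>p. p)"

text \<open>Later arguments rely only on the measurability and the law of this map, so an arbitrary
  choice serves.\<close>

definition split_unit :: "real \<Rightarrow> real \<times> real" where
  "split_unit = (SOME q. q \<in> borel_measurable borel \<and> distr unit_measure borel q = square_law)"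

lemma split_unit_measurable [measurable]: "split_unit \<in> borel_measurable borel"
  and distr_split_unit: "distr unit_measure borel split_unit = square_law"
proof -
  have "\<exists>q. q \<in> borel_measurable borel \<and> distr unit_measure borel q = square_law"
    using ex_unit_square_map by auto
  from someI_ex[OF this] show "split_unit \<in> borel_measurable borel"
    "distr unit_measure borel split_unit = square_law"
    unfolding split_unit_def by auto
qed

text \<open>\<open>unit_measure\<close> lives on the interval with its trace sigma-algebra; its law
  on the whole line has the Borel sets as measurable sets, which suits pushforwards.\<close>

abbreviation unit_law :: "real measure" where
  "unit_law \<equiv> distr unit_measure borel (\<lambda>x. x)"

lemma id_unit_measurable [measurable]: "(\<lambda>x. x) \<in> borel_measurable unit_measure"
  by (simp add: measurable_restrict_space1)

lemma id_square_measurable [measurable]: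
  "(\<lambda>p. p) \<in> borel_measurable (unit_measure \<Otimes>\<^sub>M unit_measure)"
proof -
  have "fst \<in> borel_measurable (unit_measure \<Otimes>\<^sub>M unit_measure)"
       "snd \<in> borel_measurable (unit_measure \<Otimes>\<^sub>M unit_measure)"
    by (rule measurable_compose[OF measurable_fst id_unit_measurable],
        rule measurable_compose[OF measurable_snd id_unit_measurable])
  from measurable_Pair[OF this] show ?thesis by (simp add: borel_prod)
qed

lemma prob_space_unit_law: "prob_space unit_law"
  by (rule prob_space.prob_space_distr[OF prob_space_unit_measure id_unit_measurable])

lemma prob_space_square_law: "prob_space square_law"
proof -
  interpret U: prob_space unit_measure by (rule prob_space_unit_measure)
  interpret UU: pair_prob_space unit_measure unit_measure ..
  show ?thesis by (rule UU.prob_space_distr) simp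
qed

lemma square_law_eq: "square_law = unit_law \<Otimes>\<^sub>M unit_law"
proof -
  interpret U: prob_space unit_measure by (rule prob_space_unit_measure)
  interpret L: prob_space unit_law by (rule prob_space_unit_law)
  have "unit_law \<Otimes>\<^sub>M unit_law = distr (unit_measure \<Otimes>\<^sub>M unit_measure) (borel \<Otimes>\<^sub>M borel) (\<lambda>(x, y). (x, y))"
    by (rule pair_measure_distr) (auto intro: L.sigma_finite_measure_axioms)
  then show ?thesis by (simp add: borel_prod id_def)
qed

lemma emeasure_square_law:
  assumes "X \<in> sets borel" "Y \<in> sets borel"
  shows "emeasure square_law (X \<times> Y) = emeasure unit_law X * emeasure unit_law Y"
proof -
  interpret L: prob_space unit_law by (rule prob_space_unit_law)
  show ?thesis unfolding square_law_eq
    using assms by (subst L.emeasure_pair_measure_Times) auto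
qed

lemma distr_coordinate_split_unit:
  "distr unit_measure borel (\<lambda>x. fst (split_unit x)) = unit_law"
  "distr unit_measure borel (\<lambda>x. snd (split_unit x)) = unit_law"
proof -
  interpret L: prob_space unit_law by (rule prob_space_unit_law)
  interpret LL: pair_prob_space unit_law unit_law ..
  have "distr unit_measure borel (\<lambda>x. fst (split_unit x)) = distr square_law borel fst"
    unfolding distr_split_unit[symmetric]
    by (subst distr_distr) (auto simp: comp_def measurable_restrict_space1)
  also have "\<dots> = distr (unit_law \<Otimes>\<^sub>M unit_law) unit_law fst"
    unfolding square_law_eq by (rule distr_cong) auto
  finally show "distr unit_measure borel (\<lambda>x. fst (split_unit x)) = unit_law"
    by (simp add: L.distr_pair_fst)
  have "distr unit_measure borel (\<lambda>x. snd (split_unit x)) = distr square_law borel snd"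
    unfolding distr_split_unit[symmetric]
    by (subst distr_distr) (auto simp: comp_def measurable_restrict_space1)
  also have "\<dots> = distr (unit_law \<Otimes>\<^sub>M unit_law) unit_law snd"
    unfolding square_law_eq by (rule distr_cong) auto
  also have "\<dots> = unit_law"
  proof (rule measure_eqI)
    fix X assume "X \<in> sets (distr (unit_law \<Otimes>\<^sub>M unit_law) unit_law snd)"
    then have X: "X \<in> sets unit_law" by simp
    have "snd -` X \<inter> space (unit_law \<Otimes>\<^sub>M unit_law) = UNIV \<times> X"
      by (auto simp: space_pair_measure)
    then show "emeasure (distr (unit_law \<Otimes>\<^sub>M unit_law) unit_law snd) X = emeasure unit_law X"
      using X L.emeasure_pair_measure_Times[of UNIV unit_law X] L.emeasure_space_1
      by (simp add: emeasure_distr)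
  qed simp
  finally show "distr unit_measure borel (\<lambda>x. snd (split_unit x)) = unit_law" .
qed

section \<open>Bounded kernels and their tensor products\<close>

text \<open>Borel rather than Lebesgue measurable, since \<open>tensor\<close> composes kernels with
  \<open>split_unit\<close>; bounded on the whole plane, since \<open>split_unit\<close> is
  controlled only up to null sets.\<close>

definition bounded_borel :: "(real \<times> real \<Rightarrow> real) set" where
  "bounded_borel = {f \<in> borel_measurable borel. \<exists>C. \<forall>p. \<bar>f p\<bar> \<le> C}"

lemma bounded_borel_measurable: "f \<in> bounded_borel \<Longrightarrow> f \<in> borel_measurable borel"
  by (simp add: bounded_borel_def)

text \<open>Each argument is split into two independent uniform variables, one seen by
  \<open>f\<close> and one by \<open>g\<close>: the tensor product of kernels, carried back to the
  unit interval.\<close>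

definition tensor :: "(real \<times> real \<Rightarrow> real) \<Rightarrow> (real \<times> real \<Rightarrow> real) \<Rightarrow> real \<times> real \<Rightarrow> real" where
  "tensor f g p = f (fst (split_unit (fst p)), fst (split_unit (snd p))) *
                  g (snd (split_unit (fst p)), snd (split_unit (snd p)))"

lemma tensor_bounded_borel:
  assumes f: "f \<in> bounded_borel" and g: "g \<in> bounded_borel"
  shows "tensor f g \<in> bounded_borel"
proof -
  have [measurable]: "f \<in> borel_measurable borel" "g \<in> borel_measurable borel"
    using f g by (auto simp: bounded_borel_def)
  obtain C D where C: "\<And>p. \<bar>f p\<bar> \<le> C" and D: "\<And>p. \<bar>g p\<bar> \<le> D"
    using f g by (auto simp: bounded_borel_def)
  have "(\<lambda>p. (fst (split_unit (fst p)), fst (split_unit (snd p)))) \<in> borel_measurable borel"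
    "(\<lambda>p. (snd (split_unit (fst p)), snd (split_unit (snd p)))) \<in> borel_measurable borel"
    by (subst borel_prod[symmetric], measurable)+
  then have "tensor f g \<in> borel_measurable borel"
    unfolding tensor_def by measurable
  moreover have "\<bar>tensor f g p\<bar> \<le> C * D" for p
    unfolding tensor_def abs_mult using C D by (intro mult_mono) (auto intro: order_trans[OF abs_ge_zero])
  ultimately show ?thesis by (auto simp: bounded_borel_def)
qed

section \<open>The product measure on the cube and the independence of split coordinates\<close>

context
  fixes V :: "'v set"
  assumes V: "finite V" "V \<noteq> {}"
begin

abbreviation cube :: "('v \<Rightarrow> real) measure" where
  "cube \<equiv> Pi\<^sub>M V (\<lambda>_. unit_measure)"

lemma prob_space_cube: "prob_space cube"
  by (rule prob_space_PiM) (rule prob_space_unit_measure)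

lemma coordinate_measurable:
  assumes "v \<in> V" shows "(\<lambda>z. z v) \<in> borel_measurable cube"
  using measurable_compose[OF measurable_component_singleton[OF assms] id_unit_measurable] by simp

lemma emeasure_cube_box:
  assumes "\<And>v. v \<in> V \<Longrightarrow> X v \<in> sets borel"
  shows "emeasure cube {z \<in> space cube. \<forall>v\<in>V. z v \<in> X v} = (\<Prod>v\<in>V. emeasure unit_law (X v))"
proof -
  interpret U: prob_space unit_measure by (rule prob_space_unit_measure)
  interpret product_sigma_finite "\<lambda>_::'v. unit_measure" ..
  have "{z \<in> space cube. \<forall>v\<in>V. z v \<in> X v} = (\<Pi>\<^sub>E v\<in>V. X v \<inter> {0..1})"
    by (auto simp: space_PiM PiE_iff space_restrict_space extensional_def)
  also have "emeasure cube \<dots> = (\<Prod>v\<in>V. emeasure unit_measure (X v \<inter> {0..1}))"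
    using assms V by (intro emeasure_PiM) (auto simp: sets_restrict_space)
  also have "\<dots> = (\<Prod>v\<in>V. emeasure unit_law (X v))"
    using assms by (intro prod.cong) (auto simp: emeasure_distr space_restrict_space)
  finally show ?thesis .
qed

text \<open>Distinct coordinates are independent and uniform, as seen on rectangles by leaving all
  other sides of the box free. This carries almost everywhere statements from the square to the ends
  of an edge.\<close>

lemma distr_cube_pair:
  assumes "u \<in> V" "v \<in> V" "u \<noteq> v"
  shows "distr cube borel (\<lambda>z. (z u, z v)) = square_law"
proof -
  interpret L: prob_space unit_law by (rule prob_space_unit_law)
  interpret C: prob_space cube by (rule prob_space_cube)
  have m: "(\<lambda>z. (z u, z v)) \<in> borel_measurable cube"
    using measurable_Pair[OF coordinate_measurable coordinate_measurable, of u v] assms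
    by (simp add: borel_prod)
  have "unit_law \<Otimes>\<^sub>M unit_law = distr cube borel (\<lambda>z. (z u, z v))"
  proof (rule pair_measure_eqI)
    show "sets (unit_law \<Otimes>\<^sub>M unit_law) = sets (distr cube borel (\<lambda>z. (z u, z v)))"
      by (metis square_law_eq sets_distr)
    fix X Y assume "X \<in> sets unit_law" "Y \<in> sets unit_law"
    then have XY: "X \<in> sets borel" "Y \<in> sets borel" by auto
    define Z where "Z w = (if w = u then X else if w = v then Y else UNIV)" for w
    have "emeasure (distr cube borel (\<lambda>z. (z u, z v))) (X \<times> Y)
        = emeasure cube {z \<in> space cube. \<forall>w\<in>V. z w \<in> Z w}"
      using XY m assms by (subst emeasure_distr) (auto simp: Z_def borel_Times intro!: arg_cong[of _ _ "emeasure cube"])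
    also have "\<dots> = (\<Prod>w\<in>V. emeasure unit_law (Z w))"
      by (rule emeasure_cube_box) (auto simp: Z_def XY)
    also have "\<dots> = (\<Prod>w\<in>{u, v}. emeasure unit_law (Z w))"
      using assms V L.emeasure_space_1 by (intro prod.mono_neutral_right) (auto simp: Z_def)
    also have "\<dots> = emeasure unit_law X * emeasure unit_law Y"
      using assms by (simp add: Z_def)
    finally show "emeasure unit_law X * emeasure unit_law Y = emeasure (distr cube borel (\<lambda>z. (z u, z v))) (X \<times> Y)" ..
  qed (rule L.sigma_finite_measure_axioms)+
  then show ?thesis by (simp add: square_law_eq)
qed

text \<open>The joint law of all halves is compared with the product measure on boxes: a box for the
  halves is a box for the vertices with sides \<open>Q v\<close>, preimages of rectangles under
  \<open>split_unit\<close>, whose measures factor.\<close>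

lemma indep_vars_split:
  "prob_space.indep_vars cube (\<lambda>_. borel)
     (\<lambda>(v, b) z. if b then fst (split_unit (z v)) else snd (split_unit (z v))) (V \<times> UNIV)"
  (is "prob_space.indep_vars _ _ ?X ?I")
proof -
  interpret C: prob_space cube by (rule prob_space_cube)
  interpret L: prob_space unit_law by (rule prob_space_unit_law)
  have comp: "(\<lambda>z. h (z v)) \<in> borel_measurable cube"
    if "v \<in> V" "h \<in> borel_measurable borel" for v and h :: "real \<Rightarrow> real"
    using measurable_compose[OF coordinate_measurable that(2)] that(1) by simp
  have m: "?X i \<in> borel_measurable cube" if "i \<in> ?I" for i
    using that by (cases i) (auto intro!: comp)
  have law: "distr cube borel (?X i) = unit_law" if i: "i \<in> ?I" for i
  proof -
    obtain v b where vb: "i = (v, b)" "v \<in> V" using i by auto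
    have "distr cube borel (?X i) = distr (distr cube unit_measure (\<lambda>z. z v)) borel
      (\<lambda>x. if b then fst (split_unit x) else snd (split_unit x))"
      using vb by (subst distr_distr) (auto simp: comp_def measurable_restrict_space1)
    also have "distr cube unit_measure (\<lambda>z. z v) = unit_measure"
      by (rule distr_PiM_component[OF prob_space_unit_measure vb(2)])
    finally show ?thesis
      using distr_coordinate_split_unit by (cases b) auto
  qed
  interpret F: product_sigma_finite "\<lambda>_::'v \<times> bool. unit_law" ..
  have "distr cube (\<Pi>\<^sub>M i\<in>?I. borel) (\<lambda>z. \<lambda>i\<in>?I. ?X i z) = (\<Pi>\<^sub>M i\<in>?I. unit_law)"
  proof (rule F.PiM_eqI)
    show "finite ?I" using V by simp
    show "sets (distr cube (\<Pi>\<^sub>M i\<in>?I. borel) (\<lambda>z. \<lambda>i\<in>?I. ?X i z)) = sets (\<Pi>\<^sub>M i\<in>?I. unit_law)"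
      by (simp cong: sets_PiM_cong)
    fix Y :: "'v \<times> bool \<Rightarrow> real set" assume "\<And>i. i \<in> ?I \<Longrightarrow> Y i \<in> sets unit_law"
    then have Y: "\<And>i. i \<in> ?I \<Longrightarrow> Y i \<in> sets borel" by simp
    have q: "split_unit \<in> borel_measurable unit_measure" by (simp add: measurable_restrict_space1)
    define Q where "Q v = split_unit -` (Y (v, True) \<times> Y (v, False))" for v
    have Q: "Q v \<in> sets borel" if "v \<in> V" for v
      unfolding Q_def using Y that by (intro measurable_sets_borel[OF split_unit_measurable] borel_Times) auto
    have mX: "(\<lambda>z. \<lambda>i\<in>?I. ?X i z) \<in> cube \<rightarrow>\<^sub>M (\<Pi>\<^sub>M i\<in>?I. borel)"
      by (rule measurable_restrict) (rule m)
    have "emeasure (distr cube (\<Pi>\<^sub>M i\<in>?I. borel) (\<lambda>z. \<lambda>i\<in>?I. ?X i z)) (Pi\<^sub>E ?I Y)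
      = emeasure cube ((\<lambda>z. \<lambda>i\<in>?I. ?X i z) -` (Pi\<^sub>E ?I Y) \<inter> space cube)"
      using Y V by (intro emeasure_distr mX sets_PiM_I_finite) auto
    also have "(\<lambda>z. \<lambda>i\<in>?I. ?X i z) -` (Pi\<^sub>E ?I Y) \<inter> space cube = {z \<in> space cube. \<forall>v\<in>V. z v \<in> Q v}"
      by (auto simp: Q_def PiE_iff mem_Times_iff all_bool_eq split: if_splits)
    also have "emeasure cube \<dots> = (\<Prod>v\<in>V. emeasure unit_law (Q v))"
      by (rule emeasure_cube_box[OF Q])
    also have "\<dots> = (\<Prod>v\<in>V. emeasure unit_law (Y (v, True)) * emeasure unit_law (Y (v, False)))"
    proof (rule prod.cong[OF refl])
      fix v assume v: "v \<in> V"
      have "emeasure unit_law (Q v) = emeasure unit_measure (Q v \<inter> space unit_measure)"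
        using Q[OF v] by (subst emeasure_distr) auto
      also have "\<dots> = emeasure (distr unit_measure borel split_unit) (Y (v, True) \<times> Y (v, False))"
        using Y v q unfolding Q_def by (subst emeasure_distr) (auto intro!: borel_Times)
      finally show "emeasure unit_law (Q v) = emeasure unit_law (Y (v, True)) * emeasure unit_law (Y (v, False))"
        unfolding distr_split_unit using Y v by (subst (asm) emeasure_square_law) auto
    qed
    also have "\<dots> = (\<Prod>i\<in>?I. emeasure unit_law (Y i))"
    proof -
      have "(\<Prod>v\<in>V. emeasure unit_law (Y (v, True)) * emeasure unit_law (Y (v, False)))
        = (\<Prod>v\<in>V. \<Prod>b\<in>UNIV. emeasure unit_law (Y (v, b)))"
        by (simp add: UNIV_bool mult.commute)
      then show ?thesis by (simp add: prod.cartesian_product)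
    qed
    finally show "emeasure (distr cube (\<Pi>\<^sub>M i\<in>?I. borel) (\<lambda>z. \<lambda>i\<in>?I. ?X i z)) (Pi\<^sub>E ?I Y) = \<dots>" .
  qed
  also have "\<dots> = (\<Pi>\<^sub>M i\<in>?I. distr cube borel (?X i))"
    by (rule PiM_cong) (simp_all add: law)
  finally show ?thesis
    using V by (subst C.indep_vars_iff_distr_eq_PiM') (auto intro: m)
qed

text \<open>A measure-preserving map in each coordinate preserves the product law. Taking for
  \<open>p\<close> a coordinate of \<open>split_unit\<close> and then the identity shows that the
  two integrals agree.\<close>

lemma integral_cube_measure_preserving:
  fixes G :: "('v \<Rightarrow> real) \<Rightarrow> real"
  assumes p: "p \<in> borel_measurable borel" and law: "distr unit_measure borel p = unit_law"
    and G: "G \<in> borel_measurable (\<Pi>\<^sub>M v\<in>V. borel)"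
  shows "(\<integral>z. G (\<lambda>v\<in>V. p (z v)) \<partial>cube) = (\<integral>x. G x \<partial>(\<Pi>\<^sub>M v\<in>V. unit_law))"
proof -
  have p': "p \<in> borel_measurable unit_measure" using p by (simp add: measurable_restrict_space1)
  have U: "product_prob_space (\<lambda>_::'v. unit_measure)"
    by (intro product_prob_spaceI prob_space_unit_measure)
  have L: "product_prob_space (\<lambda>_::'v. unit_law)"
    by (intro product_prob_spaceI prob_space_unit_law)
  have "distr cube (\<Pi>\<^sub>M v\<in>V. unit_law) (compose V p) = (\<Pi>\<^sub>M v\<in>V. distr unit_measure unit_law p)"
    using p' by (intro distr_PiM_finite_prob_space U L V) (simp cong: measurable_cong_sets)
  also have "distr unit_measure unit_law p = unit_law"
    unfolding law[symmetric] by (rule distr_cong) auto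
  finally have d: "distr cube (\<Pi>\<^sub>M v\<in>V. unit_law) (compose V p) = (\<Pi>\<^sub>M v\<in>V. unit_law)" .
  have "(\<integral>x. G x \<partial>(\<Pi>\<^sub>M v\<in>V. unit_law)) = (\<integral>z. G (compose V p z) \<partial>cube)"
  proof -
    have "compose V p \<in> cube \<rightarrow>\<^sub>M (\<Pi>\<^sub>M v\<in>V. unit_law)"
      unfolding compose_def using p' by measurable
    moreover have "G \<in> borel_measurable (\<Pi>\<^sub>M v\<in>V. unit_law)"
      using G by (simp cong: measurable_cong_sets sets_PiM_cong)
    ultimately show ?thesis
      using integral_distr[of "compose V p" cube "\<Pi>\<^sub>M v\<in>V. unit_law" G] unfolding d by simp
  qed
  then show ?thesis by (simp add: compose_def)
qed

text \<open>The first halves and the second halves form independent families, so the expectation of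
  the product factors, and each family has the same law as the original coordinates.\<close>

lemma integral_cube_split:
  fixes G G' :: "('v \<Rightarrow> real) \<Rightarrow> real"
  assumes G: "G \<in> borel_measurable (\<Pi>\<^sub>M v\<in>V. borel)" "\<And>x. \<bar>G x\<bar> \<le> C"
    and G': "G' \<in> borel_measurable (\<Pi>\<^sub>M v\<in>V. borel)" "\<And>x. \<bar>G' x\<bar> \<le> C'"
  shows "(\<integral>z. G (\<lambda>v\<in>V. fst (split_unit (z v))) * G' (\<lambda>v\<in>V. snd (split_unit (z v))) \<partial>cube)
    = (\<integral>z. G (restrict z V) \<partial>cube) * (\<integral>z. G' (restrict z V) \<partial>cube)"
proof -
  interpret C: prob_space cube by (rule prob_space_cube)
  define X where "X = (\<lambda>(v, b) z. if b then fst (split_unit (z v)) else snd (split_unit (z (v :: 'v))))"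
  let ?A = "\<lambda>z. \<lambda>i\<in>V \<times> {True}. X i z" and ?B = "\<lambda>z. \<lambda>i\<in>V \<times> {False}. X i z"
  let ?g = "\<lambda>b y. \<lambda>v\<in>V. y (v, b :: bool)"
  have split_meas: "(\<lambda>x. fst (split_unit x)) \<in> borel_measurable borel"
    "(\<lambda>x. snd (split_unit x)) \<in> borel_measurable borel"
    by measurable
  have m1: "?g b \<in> (\<Pi>\<^sub>M i\<in>V \<times> {b}. borel) \<rightarrow>\<^sub>M (\<Pi>\<^sub>M v\<in>V. borel)" for b
    by measurable
  have ind: "C.indep_var (\<Pi>\<^sub>M i\<in>V \<times> {True}. borel) ?A (\<Pi>\<^sub>M i\<in>V \<times> {False}. borel) ?B"
    using indep_vars_split by (intro C.indep_var_restrict[where I = "V \<times> UNIV"]) (auto simp: X_def)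
  have eq: "?g True (?A z) = (\<lambda>v\<in>V. fst (split_unit (z v)))"
    "?g False (?B z) = (\<lambda>v\<in>V. snd (split_unit (z v)))" for z
    by (auto simp: X_def)
  have "C.indep_var borel ((\<lambda>y. G (?g True y)) \<circ> ?A) borel ((\<lambda>y. G' (?g False y)) \<circ> ?B)"
    using measurable_compose[OF m1 G(1)] measurable_compose[OF m1 G'(1)]
    by (intro C.indep_var_compose[OF ind]) auto
  then have ind': "C.indep_var borel (\<lambda>z. G (\<lambda>v\<in>V. fst (split_unit (z v)))) borel (\<lambda>z. G' (\<lambda>v\<in>V. snd (split_unit (z v))))"
    by (simp add: comp_def X_def restrict_def cong: if_cong)
  note rv = C.indep_var_rv1[OF ind'] C.indep_var_rv2[OF ind']
  have "(\<integral>z. G (\<lambda>v\<in>V. fst (split_unit (z v))) * G' (\<lambda>v\<in>V. snd (split_unit (z v))) \<partial>cube)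
    = (\<integral>z. G (\<lambda>v\<in>V. fst (split_unit (z v))) \<partial>cube) * (\<integral>z. G' (\<lambda>v\<in>V. snd (split_unit (z v))) \<partial>cube)"
    using rv G(2) G'(2)
    by (intro C.indep_var_lebesgue_integral ind') (auto intro!: C.integrable_const_bound AE_I2)
  moreover have *: "(\<integral>z. G (\<lambda>v\<in>V. p (z v)) \<partial>cube) = (\<integral>z. G (restrict z V) \<partial>cube)"
    if "G \<in> borel_measurable (\<Pi>\<^sub>M v\<in>V. borel)" "p \<in> borel_measurable borel"
      "distr unit_measure borel p = unit_law" for G :: "('v \<Rightarrow> real) \<Rightarrow> real" and p
    using integral_cube_measure_preserving[OF that(2,3,1)]
      integral_cube_measure_preserving[OF _ refl that(1)] by (simp add: restrict_def)
  ultimately show ?thesis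
    using *[OF G(1) split_meas(1) distr_coordinate_split_unit(1)]
      *[OF G'(1) split_meas(2) distr_coordinate_split_unit(2)] by simp
qed

end

section \<open>Transposition, the half kernel and tensor powers\<close>

definition flip :: "(real \<times> real \<Rightarrow> real) \<Rightarrow> real \<times> real \<Rightarrow> real" where
  "flip f p = f (snd p, fst p)"

text \<open>For \<open>a\<close> in \<open>{0, 1}\<close> this is the factor of \<open>r_H\<close>
  at an edge with exponent \<open>a\<close>.\<close>

definition orient :: "nat \<Rightarrow> (real \<times> real \<Rightarrow> real) \<Rightarrow> real \<times> real \<Rightarrow> real" where
  "orient a f = (if a = 1 then f else flip f)"

text \<open>A directed edge between the two halves of the interval: as a tensor factor it makes
  orientations visible and lets only consistent ones survive.\<close>

definition half_kernel :: "real \<times> real \<Rightarrow> real" where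
  "half_kernel p = (if fst p < 1 / 2 \<and> 1 / 2 \<le> snd p then 1 else 0)"

lemma flip_flip [simp]: "flip (flip f) = f"
  by (simp add: flip_def fun_eq_iff)

lemma flip_bounded_borel: "f \<in> bounded_borel \<Longrightarrow> flip f \<in> bounded_borel"
proof -
  assume f: "f \<in> bounded_borel"
  then have [measurable]: "f \<in> borel_measurable borel" by (simp add: bounded_borel_def)
  have "(\<lambda>p. (snd p, fst p)) \<in> borel_measurable (borel :: (real \<times> real) measure)"
    by (subst borel_prod[symmetric], measurable)
  then have "flip f \<in> borel_measurable borel" unfolding flip_def by measurable
  then show ?thesis using f by (auto simp: bounded_borel_def flip_def)
qed

lemma orient_bounded_borel: "f \<in> bounded_borel \<Longrightarrow> orient a f \<in> bounded_borel"
  by (simp add: orient_def flip_bounded_borel)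

lemma half_kernel_bounded_borel: "half_kernel \<in> bounded_borel"
proof -
  have "half_kernel \<in> borel_measurable borel" unfolding half_kernel_def by measurable
  then show ?thesis by (auto simp: bounded_borel_def half_kernel_def intro!: exI[of _ 1])
qed

lemma bounded_borel_add:
  assumes "f \<in> bounded_borel" "g \<in> bounded_borel" shows "(\<lambda>p. f p + g p) \<in> bounded_borel"
proof -
  obtain C D where "\<And>p. \<bar>f p\<bar> \<le> C" "\<And>p. \<bar>g p\<bar> \<le> D"
    using assms by (auto simp: bounded_borel_def)
  then have "\<bar>f p + g p\<bar> \<le> C + D" for p by (meson abs_triangle_ineq add_mono order_trans)
  then show ?thesis using assms by (auto simp: bounded_borel_def intro!: exI[of _ "C + D"])
qed

lemma bounded_borel_cmult:
  assumes "f \<in> bounded_borel" shows "(\<lambda>p. c * f p) \<in> bounded_borel"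
proof -
  obtain C where "\<And>p. \<bar>f p\<bar> \<le> C" using assms by (auto simp: bounded_borel_def)
  then have "\<bar>c * f p\<bar> \<le> \<bar>c\<bar> * C" for p by (simp add: abs_mult mult_left_mono)
  then show ?thesis using assms by (auto simp: bounded_borel_def intro!: exI[of _ "\<bar>c\<bar> * C"])
qed

lemma bounded_borel_const: "(\<lambda>p. c) \<in> bounded_borel"
  by (auto simp: bounded_borel_def)

lemma bounded_borel_abs: "f \<in> bounded_borel \<Longrightarrow> (\<lambda>p. \<bar>f p\<bar>) \<in> bounded_borel"
  by (auto simp: bounded_borel_def)

lemma flip_tensor: "flip (tensor f g) = tensor (flip f) (flip g)"
  by (simp add: fun_eq_iff flip_def tensor_def)

lemma orient_tensor: "orient a (tensor f g) = tensor (orient a f) (orient a g)"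
  by (simp add: orient_def flip_tensor)

lemma orient_add: "orient a (\<lambda>p. f p + g p) = (\<lambda>p. orient a f p + orient a g p)"
  by (auto simp: orient_def flip_def)

lemma orient_cmult: "orient a (\<lambda>p. c * f p) = (\<lambda>p. c * orient a f p)"
  by (auto simp: orient_def flip_def)

text \<open>\<open>tensor_power f k\<close> is the tensor power with exponent \<open>2\<^sup>k\<close>, which is even for \<open>k > 0\<close>.\<close>

fun tensor_power :: "(real \<times> real \<Rightarrow> real) \<Rightarrow> nat \<Rightarrow> real \<times> real \<Rightarrow> real" where
  "tensor_power f 0 = f"
| "tensor_power f (Suc k) = tensor (tensor_power f k) (tensor_power f k)"

lemma tensor_power_bounded_borel: "f \<in> bounded_borel \<Longrightarrow> tensor_power f k \<in> bounded_borel"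
  by (induction k) (auto intro: tensor_bounded_borel)

lemma flip_tensor_power: "flip (tensor_power f k) = tensor_power (flip f) k"
  by (induction k) (simp_all add: flip_tensor)

text \<open>The flag \<open>s\<close> selects nonnegative kernels; it lets one argument serve norming and weakly norming.\<close>

definition kernel_class :: "bool \<Rightarrow> (real \<times> real \<Rightarrow> real) set" where
  "kernel_class s = {f \<in> bounded_borel. s \<longrightarrow> (\<forall>p. 0 \<le> f p)}"

lemma kernel_class_bounded_borel: "f \<in> kernel_class s \<Longrightarrow> f \<in> bounded_borel"
  by (simp add: kernel_class_def)

lemma kernel_class_intros:
  "f \<in> kernel_class s \<Longrightarrow> g \<in> kernel_class s \<Longrightarrow> (\<lambda>p. f p + g p) \<in> kernel_class s"
  "f \<in> kernel_class s \<Longrightarrow> 0 \<le> c \<Longrightarrow> (\<lambda>p. c * f p) \<in> kernel_class s"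
  "f \<in> kernel_class s \<Longrightarrow> flip f \<in> kernel_class s"
  "f \<in> kernel_class s \<Longrightarrow> orient a f \<in> kernel_class s"
  "f \<in> kernel_class s \<Longrightarrow> g \<in> kernel_class s \<Longrightarrow> tensor f g \<in> kernel_class s"
  "half_kernel \<in> kernel_class s"
  "(\<lambda>p. 0) \<in> kernel_class s"
  by (auto simp: kernel_class_def bounded_borel_add bounded_borel_cmult flip_bounded_borel
      orient_bounded_borel tensor_bounded_borel half_kernel_bounded_borel bounded_borel_const)
     (auto simp: flip_def orient_def tensor_def half_kernel_def)

lemma kernel_class_tensor_power: "f \<in> kernel_class s \<Longrightarrow> tensor_power f k \<in> kernel_class s"
  by (induction k) (simp_all add: kernel_class_intros)

lemma kernel_class_sum:
  assumes "finite I" "\<And>i. i \<in> I \<Longrightarrow> f i \<in> kernel_class s"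
  shows "(\<lambda>p. \<Sum>i\<in>I. f i p) \<in> kernel_class s"
  using assms by (induction I rule: finite_induct) (simp_all add: kernel_class_intros)

text \<open>The end of a tensor power argument: a constant independent of the exponent disappears,
  since the powers of \<open>x / y > 1\<close> are unbounded.\<close>

lemma le_of_pow_two_powers:
  fixes x y c :: real
  assumes "0 \<le> x" "0 \<le> y" and le: "\<And>k. x ^ 2 ^ Suc k \<le> c * y ^ 2 ^ Suc k"
  shows "x \<le> y"
proof (rule ccontr)
  assume "\<not> x \<le> y"
  then have xy: "y < x" by simp
  show False
  proof (cases "y = 0")
    case True
    then have "x ^ 2 ^ Suc 0 \<le> 0" using le[of 0] by simp
    then show False using xy True by simp
  next
    case False
    then have y: "0 < y" using assms by simp
    then have "1 < x / y" using xy by simp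
    then obtain n where n: "c < (x / y) ^ n" using real_arch_pow by blast
    have "n \<le> 2 ^ Suc n" using less_exp[of "Suc n"] by linarith
    then have "(x / y) ^ n \<le> (x / y) ^ 2 ^ Suc n"
      using \<open>1 < x / y\<close> by (intro power_increasing) auto
    also have "\<dots> \<le> c" using le[of n] y by (simp add: power_divide divide_le_eq)
    finally show False using n by simp
  qed
qed

lemma power_powr_commute:
  fixes x :: real
  assumes "0 \<le> x" "0 < n" shows "(x ^ n) powr a = (x powr a) ^ n"
proof (cases "x = 0")
  case False
  then show ?thesis using assms by (simp add: powr_realpow[symmetric] powr_powr mult.commute)
qed (use assms in \<open>simp add: power_0_left\<close>)

section \<open>Decorated homomorphism densities\<close>

locale connected_bipartite_graph =
  fixes A B :: "'v set" and E :: "('v \<times> 'v) set"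
  assumes graph: "bipartite_graph A B E"
    and no_isolated: "no_isolated_vertices A B E"
    and connected: "connected_graph A B E"
begin

abbreviation V :: "'v set" where "V \<equiv> A \<union> B"

lemma finite_V: "finite V" and V_ne: "V \<noteq> {}" and disjoint: "A \<inter> B = {}" and E_subset: "E \<subseteq> A \<times> B"
  using graph by (auto simp: bipartite_graph_def)

lemma finite_E: "finite E"
  using finite_subset[OF E_subset] finite_V by simp

lemma edge_V: "e \<in> E \<Longrightarrow> fst e \<in> V" "e \<in> E \<Longrightarrow> snd e \<in> V"
  using E_subset by auto

lemma edge_neq: "e \<in> E \<Longrightarrow> fst e \<noteq> snd e"
  using E_subset disjoint by (cases e) auto

lemma E_ne: "E \<noteq> {}"
  using no_isolated V_ne by (auto simp: no_isolated_vertices_def)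

abbreviation m :: nat where "m \<equiv> card E"

lemma m_pos: "0 < m"
  using finite_E E_ne by (simp add: card_gt_0_iff)

lemma root_m_power:
  assumes "0 \<le> x" shows "(x powr (1 / real m)) ^ m = x"
proof -
  have "(x powr (1 / real m)) ^ m = (x ^ m) powr (1 / real m)"
    using assms m_pos by (simp add: power_powr_commute)
  also have "\<dots> = x"
    using assms m_pos by (cases "x = 0") (simp_all add: powr_realpow[symmetric] powr_powr)
  finally show ?thesis .
qed

lemma root_m_of_power: "0 \<le> x \<Longrightarrow> (x ^ m) powr (1 / real m) = x"
  using root_m_power m_pos by (simp add: power_powr_commute)

text \<open>Every edge carries its own kernel, as multilinear expansion and Hoelder inequalities
  require. The cube is not completed, because Borel kernels already give measurable
  integrands.\<close>

definition hom :: "('v \<times> 'v \<Rightarrow> real \<times> real \<Rightarrow> real) \<Rightarrow> real" where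
  "hom F = (\<integral>z. (\<Prod>e\<in>E. F e (z (fst e), z (snd e))) \<partial>cube V)"

abbreviation hom1 :: "(real \<times> real \<Rightarrow> real) \<Rightarrow> real" where
  "hom1 f \<equiv> hom (\<lambda>_. f)"

lemma prod_measurable:
  fixes F :: "'v \<times> 'v \<Rightarrow> real \<times> real \<Rightarrow> real"
  assumes F: "\<And>e. e \<in> E \<Longrightarrow> F e \<in> borel_measurable borel"
    and N: "(\<lambda>x. x) \<in> borel_measurable N"
  shows "(\<lambda>z. \<Prod>e\<in>E. F e (z (fst e), z (snd e))) \<in> borel_measurable (\<Pi>\<^sub>M v\<in>V. N)"
proof (rule borel_measurable_prod)
  fix e assume e: "e \<in> E"
  have c: "(\<lambda>z. z v) \<in> borel_measurable (\<Pi>\<^sub>M v\<in>V. N)" if "v \<in> V" for v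
    using measurable_compose[OF measurable_component_singleton[OF that] N] by simp
  have "(\<lambda>z. (z (fst e), z (snd e))) \<in> borel_measurable (\<Pi>\<^sub>M v\<in>V. N)"
    using measurable_Pair[OF c c] edge_V[OF e] by (simp add: borel_prod)
  from measurable_compose[OF this F[OF e]]
  show "(\<lambda>z. F e (z (fst e), z (snd e))) \<in> borel_measurable (\<Pi>\<^sub>M v\<in>V. N)" by simp
qed

lemma prod_bounded:
  assumes "\<And>e. e \<in> E \<Longrightarrow> F e \<in> bounded_borel"
  obtains C where "\<And>z. \<bar>\<Prod>e\<in>E. F e (z (fst e), z (snd e))\<bar> \<le> C"
proof -
  have "\<forall>e\<in>E. \<exists>C. \<forall>p. \<bar>F e p\<bar> \<le> C" using assms by (auto simp: bounded_borel_def)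
  then obtain C where "\<forall>e\<in>E. \<forall>p. \<bar>F e p\<bar> \<le> C e" by metis
  then have "\<bar>\<Prod>e\<in>E. F e (z (fst e), z (snd e))\<bar> \<le> (\<Prod>e\<in>E. C e)" for z
    unfolding abs_prod by (intro prod_mono) auto
  then show ?thesis using that by blast
qed

lemma hom_integrable:
  assumes F: "\<And>e. e \<in> E \<Longrightarrow> F e \<in> bounded_borel"
  shows "integrable (cube V) (\<lambda>z. \<Prod>e\<in>E. F e (z (fst e), z (snd e)))"
proof -
  interpret prob_space "cube V" by (rule prob_space_cube[OF finite_V V_ne])
  obtain C where "\<And>z. \<bar>\<Prod>e\<in>E. F e (z (fst e), z (snd e))\<bar> \<le> C"
    using prod_bounded[of F] F by blast
  then show ?thesis
    using F by (intro integrable_const_bound[of _ C] prod_measurable) (auto simp: bounded_borel_def)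
qed

lemma hom_cong: "(\<And>e. e \<in> E \<Longrightarrow> F e = G e) \<Longrightarrow> hom F = hom G"
  unfolding hom_def by (intro Bochner_Integration.integral_cong prod.cong) auto

lemma hom_nonneg: "(\<And>e p. e \<in> E \<Longrightarrow> 0 \<le> F e p) \<Longrightarrow> 0 \<le> hom F"
  unfolding hom_def by (intro integral_nonneg_AE AE_I2 prod_nonneg) auto

lemma hom_mono:
  assumes "\<And>e. e \<in> E \<Longrightarrow> F e \<in> bounded_borel" "\<And>e. e \<in> E \<Longrightarrow> G e \<in> bounded_borel"
    and "\<And>e p. e \<in> E \<Longrightarrow> 0 \<le> F e p" "\<And>e p. e \<in> E \<Longrightarrow> F e p \<le> G e p"
  shows "hom F \<le> hom G"
  unfolding hom_def using assms by (intro integral_mono hom_integrable prod_mono) auto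

lemma hom_cmult: "hom (\<lambda>e p. c e * F e p) = (\<Prod>e\<in>E. c e) * hom F"
  unfolding hom_def by (simp add: prod.distrib)

text \<open>Multilinearity: the product over edges is expanded over the functions \<open>g\<close>
  that choose a summand at each edge.\<close>

lemma hom_sum:
  assumes I: "finite I" and F: "\<And>e i. e \<in> E \<Longrightarrow> i \<in> I \<Longrightarrow> F e i \<in> bounded_borel"
  shows "hom (\<lambda>e p. \<Sum>i\<in>I. F e i p) = (\<Sum>g\<in>E \<rightarrow>\<^sub>E I. hom (\<lambda>e. F e (g e)))"
proof -
  have "hom (\<lambda>e p. \<Sum>i\<in>I. F e i p)
    = (\<integral>z. (\<Sum>g\<in>E \<rightarrow>\<^sub>E I. \<Prod>e\<in>E. F e (g e) (z (fst e), z (snd e))) \<partial>cube V)"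
    unfolding hom_def using I finite_E by (subst prod_sum_PiE) auto
  also have "\<dots> = (\<Sum>g\<in>E \<rightarrow>\<^sub>E I. hom (\<lambda>e. F e (g e)))"
    unfolding hom_def using F by (intro Bochner_Integration.integral_sum hom_integrable) auto
  finally show ?thesis .
qed

text \<open>After splitting every vertex variable, the integrand is a function of the first halves
  times a function of the second halves, and these are independent.\<close>

lemma hom_tensor:
  assumes F: "\<And>e. e \<in> E \<Longrightarrow> F e \<in> bounded_borel" and G: "\<And>e. e \<in> E \<Longrightarrow> G e \<in> bounded_borel"
  shows "hom (\<lambda>e. tensor (F e) (G e)) = hom F * hom G"
proof -
  let ?P = "\<lambda>F z. \<Prod>e\<in>E. F e (z (fst e), z (snd e) :: real) :: real"
  obtain C where C: "\<And>z. \<bar>?P F z\<bar> \<le> C" using prod_bounded[of F] F by blast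
  obtain D where D: "\<And>z. \<bar>?P G z\<bar> \<le> D" using prod_bounded[of G] G by blast
  \<comment> \<open>The splitting formula evaluates integrands at restricted points; the ends of all
    edges lie in \<open>V\<close>, so restriction changes nothing.\<close>
  have r: "?P K (restrict z V) = ?P K z" for K and z :: "'v \<Rightarrow> real"
    using edge_V by (intro prod.cong) auto
  have "hom (\<lambda>e. tensor (F e) (G e))
     = (\<integral>z. ?P F (\<lambda>v\<in>V. fst (split_unit (z v))) * ?P G (\<lambda>v\<in>V. snd (split_unit (z v))) \<partial>cube V)"
    unfolding hom_def prod.distrib[symmetric]
    by (intro Bochner_Integration.integral_cong prod.cong) (use edge_V in \<open>auto simp: tensor_def\<close>)
  also have "\<dots> = (\<integral>z. ?P F (restrict z V) \<partial>cube V) * (\<integral>z. ?P G (restrict z V) \<partial>cube V)"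
    using F G C D
    by (intro integral_cube_split[OF finite_V V_ne] prod_measurable) (auto simp: bounded_borel_def)
  finally show ?thesis unfolding r hom_def .
qed

lemma hom_tensor_power:
  assumes F: "\<And>e. e \<in> E \<Longrightarrow> F e \<in> bounded_borel"
  shows "hom (\<lambda>e. tensor_power (F e) k) = hom F ^ 2 ^ k"
proof (induction k)
  case (Suc k)
  have "hom (\<lambda>e. tensor_power (F e) (Suc k)) = hom F ^ 2 ^ k * hom F ^ 2 ^ k"
    unfolding tensor_power.simps by (subst hom_tensor) (simp_all only: tensor_power_bounded_borel F Suc)
  also have "\<dots> = hom F ^ 2 ^ Suc k" by (simp only: power_Suc mult_2 power_add)
  finally show ?case .
qed simp

text \<open>With 1 on all other edges a density is an integral over the square, so the
  multiplicativity of \<open>hom\<close> passes to such integrals.\<close>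

lemma hom_single_edge:
  assumes e: "e0 \<in> E" and f: "f \<in> bounded_borel"
  shows "hom (\<lambda>e. if e = e0 then f else (\<lambda>_. 1)) = (\<integral>p. f p \<partial>square_law)"
proof -
  have "(\<Prod>e\<in>E. (if e = e0 then f else (\<lambda>_. 1)) (z (fst e), z (snd e))) = f (z (fst e0), z (snd e0))" for z
  proof -
    have "(\<Prod>e\<in>E. (if e = e0 then f else (\<lambda>_. 1)) (z (fst e), z (snd e)))
        = (\<Prod>e\<in>E. if e = e0 then f (z (fst e), z (snd e)) else 1)"
      by (rule prod.cong) auto
    then show ?thesis using e finite_E by simp
  qed
  moreover have "(\<integral>z. f (z (fst e0), z (snd e0)) \<partial>cube V) = (\<integral>p. f p \<partial>square_law)"
  proof -
    have "(\<lambda>z. (z (fst e0), z (snd e0))) \<in> borel_measurable (cube V)"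
      using measurable_Pair[OF coordinate_measurable coordinate_measurable, OF finite_V V_ne _ finite_V V_ne]
        edge_V[OF e] by (simp add: borel_prod)
    from integral_distr[OF this bounded_borel_measurable[OF f]]
    show ?thesis
      using distr_cube_pair[OF finite_V V_ne edge_V(1)[OF e] edge_V(2)[OF e] edge_neq[OF e]] by simp
  qed
  ultimately show ?thesis by (simp add: hom_def)
qed

lemma integral_tensor:
  assumes f: "f \<in> bounded_borel" and g: "g \<in> bounded_borel"
  shows "(\<integral>p. tensor f g p \<partial>square_law) = (\<integral>p. f p \<partial>square_law) * (\<integral>p. g p \<partial>square_law)"
proof -
  obtain e0 where e0: "e0 \<in> E" using E_ne by auto
  have "tensor (if e = e0 then f else (\<lambda>_. 1)) (if e = e0 then g else (\<lambda>_. 1))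
     = (if e = e0 then tensor f g else (\<lambda>_. 1))" for e
    by (auto simp: tensor_def)
  then have "hom (\<lambda>e. if e = e0 then tensor f g else (\<lambda>_. 1))
    = hom (\<lambda>e. if e = e0 then f else (\<lambda>_. 1)) * hom (\<lambda>e. if e = e0 then g else (\<lambda>_. 1))"
    using hom_tensor[of "\<lambda>e. if e = e0 then f else (\<lambda>_. 1)" "\<lambda>e. if e = e0 then g else (\<lambda>_. 1)"] f g
    by (auto simp: bounded_borel_const)
  then show ?thesis
    by (simp add: hom_single_edge[OF e0] f g tensor_bounded_borel)
qed

lemma integrable_square_law:
  assumes "f \<in> bounded_borel" shows "integrable square_law f"
proof -
  interpret prob_space square_law by (rule prob_space_square_law)
  obtain C where "\<And>p. \<bar>f p\<bar> \<le> C" using assms by (auto simp: bounded_borel_def)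
  then show ?thesis
    using assms by (intro integrable_const_bound[of _ C]) (auto simp: bounded_borel_def)
qed

lemma AE_zero_iff:
  assumes "f \<in> bounded_borel"
  shows "(AE p in square_law. f p = 0) \<longleftrightarrow> (\<integral>p. \<bar>f p\<bar> \<partial>square_law) = 0"
  using integral_nonneg_eq_0_iff_AE[OF integrable_square_law[OF bounded_borel_abs[OF assms]]]
  by simp

text \<open>The absolute value of a tensor product is the tensor product of the absolute values, and
  its integral is the product of theirs; if it vanishes, one factor does.\<close>

lemma AE_tensor_zero:
  assumes f: "f \<in> bounded_borel" and g: "g \<in> bounded_borel"
    and "AE p in square_law. tensor f g p = 0"
  shows "(AE p in square_law. f p = 0) \<or> (AE p in square_law. g p = 0)"
proof -
  have "(\<integral>p. \<bar>tensor f g p\<bar> \<partial>square_law) = 0"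
    using AE_zero_iff[OF tensor_bounded_borel[OF f g]] assms(3) by simp
  also have "(\<lambda>p. \<bar>tensor f g p\<bar>) = tensor (\<lambda>p. \<bar>f p\<bar>) (\<lambda>p. \<bar>g p\<bar>)"
    by (auto simp: tensor_def abs_mult)
  finally have "(\<integral>p. \<bar>f p\<bar> \<partial>square_law) * (\<integral>p. \<bar>g p\<bar> \<partial>square_law) = 0"
    by (simp add: integral_tensor bounded_borel_abs f g)
  then show ?thesis using AE_zero_iff f g by auto
qed

text \<open>The ends of an edge, taken in either order, form a uniform pair, so transposition
  preserves null sets.\<close>

lemma AE_flip_zero:
  assumes f: "f \<in> bounded_borel" and ae: "AE p in square_law. flip f p = 0"
  shows "AE p in square_law. f p = 0"
proof -
  obtain e where e: "e \<in> E" using E_ne by auto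
  let ?u = "fst e" and ?v = "snd e"
  have m: "(\<lambda>z. (z u, z v)) \<in> borel_measurable (cube V)" if "u \<in> V" "v \<in> V" for u v
    using measurable_Pair[OF coordinate_measurable coordinate_measurable, OF finite_V V_ne _ finite_V V_ne] that
    by (simp add: borel_prod)
  have law: "(AE p in square_law. h p = 0) \<longleftrightarrow> (AE z in cube V. h (z u, z v) = 0)"
    if h: "h \<in> bounded_borel" and uv: "u \<in> V" "v \<in> V" "u \<noteq> v" for h u v
  proof -
    have [measurable]: "h \<in> borel_measurable borel" using h by (simp add: bounded_borel_def)
    have "{p \<in> space borel. h p = 0} \<in> sets borel" by measurable
    from AE_distr_iff[OF m[OF uv(1,2)] this, unfolded distr_cube_pair[OF finite_V V_ne uv]]
    show ?thesis .
  qed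
  have "AE z in cube V. flip f (z ?u, z ?v) = 0"
    using law[of "flip f" ?u ?v] f ae edge_V[OF e] edge_neq[OF e] by (simp add: flip_bounded_borel)
  then have "AE z in cube V. f (z ?v, z ?u) = 0" by (simp add: flip_def)
  then show ?thesis
    using law[of f ?v ?u] f edge_V[OF e] edge_neq[OF e] by auto
qed

section \<open>Densities of the oriented half kernel\<close>

lemma prod_half_kernel:
  "(\<Prod>e\<in>E. orient (a e) half_kernel (z (fst e), z (snd e)))
    = (if \<forall>e\<in>E. if a e = 1 then z (fst e) < 1 / 2 \<and> 1 / 2 \<le> z (snd e)
                 else z (snd e) < 1 / 2 \<and> 1 / 2 \<le> z (fst e) then 1 else 0)"
proof -
  have eq: "orient (a e) half_kernel (z (fst e), z (snd e)) =
     (if (if a e = 1 then z (fst e) < 1 / 2 \<and> 1 / 2 \<le> z (snd e)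
                 else z (snd e) < 1 / 2 \<and> 1 / 2 \<le> z (fst e)) then 1 else 0)" for e
    by (auto simp: orient_def flip_def half_kernel_def)
  show ?thesis unfolding eq using finite_E
    by (auto intro!: prod.neutral simp: prod_zero_iff)
qed

text \<open>A vertex incident with edges of both orientations would have to lie in both halves of the interval.\<close>

lemma hom_half_kernel_nonconstant:
  assumes e: "e \<in> E" "e' \<in> E" and ne: "a e = 1" "a e' \<noteq> 1"
  shows "hom (\<lambda>e. orient (a e) half_kernel) = 0"
proof -
  have "\<not> (\<forall>e\<in>E. if a e = 1 then z (fst e) < 1 / 2 \<and> 1 / 2 \<le> z (snd e)
                 else z (snd e) < 1 / 2 \<and> 1 / 2 \<le> z (fst e))" (is "\<not> ?P")
    for z :: "'v \<Rightarrow> real"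
  proof
    assume P: ?P
    \<comment> \<open>The ends of an edge lie on different sides and, whatever the orientation, in
      different halves. Whether side and half agree is therefore constant along paths.\<close>
    have step: "(x \<in> A \<longleftrightarrow> z x < 1 / 2) \<longleftrightarrow> (y \<in> A \<longleftrightarrow> z y < 1 / 2)" if "(x, y) \<in> E \<union> E\<inverse>" for x y
    proof -
      have "(u \<in> A \<longleftrightarrow> z u < 1 / 2) \<longleftrightarrow> (v \<in> A \<longleftrightarrow> z v < 1 / 2)" if uv: "(u, v) \<in> E" for u v
      proof -
        have "u \<in> A" "v \<notin> A" using uv E_subset disjoint by auto
        then show ?thesis using bspec[OF P uv] by (auto split: if_splits)
      qed
      then show ?thesis using that by auto
    qed
    have "(fst e, fst e') \<in> (E \<union> E\<inverse>)\<^sup>*"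
      using connected edge_V[OF e(1)] edge_V[OF e(2)] by (auto simp: connected_graph_def)
    then have "(fst e \<in> A \<longleftrightarrow> z (fst e) < 1 / 2) \<longleftrightarrow> (fst e' \<in> A \<longleftrightarrow> z (fst e') < 1 / 2)"
      by (induction rule: rtrancl_induct) (use step in auto)
    moreover have "fst e \<in> A" "fst e' \<in> A" using e E_subset by auto
    ultimately show False using bspec[OF P e(1)] bspec[OF P e(2)] ne by auto
  qed
  then have "(\<Prod>e\<in>E. orient (a e) half_kernel (z (fst e), z (snd e))) = 0" for z :: "'v \<Rightarrow> real"
    unfolding prod_half_kernel by (rule if_not_P)
  then show ?thesis unfolding hom_def by simp
qed

text \<open>The volume of the box confining the vertices of \<open>A\<close> to one half of the
  interval and those of \<open>B\<close> to the other.\<close>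

definition half_weight :: real where "half_weight = (1 / 2) ^ card V"

lemma half_weight_pos: "0 < half_weight" by (simp add: half_weight_def)

lemma measure_unit_law_halves:
  "emeasure unit_law {..<1 / 2} = ennreal (1 / 2)" "emeasure unit_law {1 / 2..} = ennreal (1 / 2)"
proof -
  have "{..<1 / 2} \<inter> {0..1} = {0..<1 / 2::real}" "{1 / 2..} \<inter> {0..1} = {1 / 2..1::real}" by auto
  moreover have "emeasure unit_measure {0..<1 / 2} = emeasure lborel {0..<1 / 2::real}"
    "emeasure unit_measure {1 / 2..1} = emeasure lborel {1 / 2..1::real}"
    by (rule emeasure_restrict_space; auto)+
  ultimately show "emeasure unit_law {..<1 / 2} = ennreal (1 / 2)" "emeasure unit_law {1 / 2..} = ennreal (1 / 2)"
    by (simp_all add: emeasure_distr space_restrict_space)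
qed

text \<open>For a constant orientation the edge conditions amount to one condition per vertex, as
  every vertex has an edge; what remains is a box with all sides of length
  \<open>1 / 2\<close>.\<close>

lemma hom_half_kernel_constant:
  assumes a: "(\<forall>e\<in>E. a e = 1) \<or> (\<forall>e\<in>E. a e \<noteq> 1)"
  shows "hom (\<lambda>e. orient (a e) half_kernel) = half_weight"
proof -
  obtain b where b: "\<And>e. e \<in> E \<Longrightarrow> (a e = 1) = b" using a by metis
  define X where "X v = (if (v \<in> A) = b then {..<1 / 2} else {1 / 2::real..})" for v
  have iff: "(\<forall>e\<in>E. if a e = 1 then z (fst e) < 1 / 2 \<and> 1 / 2 \<le> z (snd e)
                 else z (snd e) < 1 / 2 \<and> 1 / 2 \<le> z (fst e)) \<longleftrightarrow> (\<forall>v\<in>V. z v \<in> X v)" (is "?L \<longleftrightarrow> ?R")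
    for z :: "'v \<Rightarrow> real"
  proof
    assume L: ?L
    show ?R
    proof
      fix v assume "v \<in> V"
      then obtain w where "(v, w) \<in> E \<or> (w, v) \<in> E"
        using no_isolated by (auto simp: no_isolated_vertices_def)
      then show "z v \<in> X v"
      proof
        assume vw: "(v, w) \<in> E"
        then have "v \<in> A" using E_subset by auto
        then show ?thesis using bspec[OF L vw] b[OF vw] by (auto simp: X_def split: if_splits)
      next
        assume vw: "(w, v) \<in> E"
        then have "v \<notin> A" using E_subset disjoint by auto
        then show ?thesis using bspec[OF L vw] b[OF vw] by (auto simp: X_def split: if_splits)
      qed
    qed
  next
    assume R: ?R
    show ?L
    proof
      fix e assume e: "e \<in> E"
      have "fst e \<in> A" "snd e \<notin> A" using e E_subset disjoint by (cases e; auto)+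
      moreover have "z (fst e) \<in> X (fst e)" "z (snd e) \<in> X (snd e)"
        using bspec[OF R edge_V(1)[OF e]] bspec[OF R edge_V(2)[OF e]] by auto
      ultimately show "if a e = 1 then z (fst e) < 1 / 2 \<and> 1 / 2 \<le> z (snd e)
                 else z (snd e) < 1 / 2 \<and> 1 / 2 \<le> z (fst e)"
        using b[OF e] by (cases b) (simp_all add: X_def)
    qed
  qed
  have "hom (\<lambda>e. orient (a e) half_kernel) = (\<integral>z. indicat_real {z \<in> space (cube V). \<forall>v\<in>V. z v \<in> X v} z \<partial>cube V)"
    unfolding hom_def prod_half_kernel iff
    by (rule Bochner_Integration.integral_cong) auto
  also have "\<dots> = measure (cube V) {z \<in> space (cube V). \<forall>v\<in>V. z v \<in> X v}"
    by (simp add: Int_absorb2 subset_eq)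
  also have "\<dots> = half_weight"
  proof -
    have "emeasure (cube V) {z \<in> space (cube V). \<forall>v\<in>V. z v \<in> X v} = (\<Prod>v\<in>V. emeasure unit_law (X v))"
      by (rule emeasure_cube_box[OF finite_V V_ne]) (auto simp: X_def)
    also have "\<dots> = (\<Prod>v\<in>V. ennreal (1 / 2))"
      by (rule prod.cong) (auto simp: X_def measure_unit_law_halves)
    also have "\<dots> = ennreal half_weight"
      unfolding prod_constant half_weight_def by (rule ennreal_power) simp
    finally show ?thesis
      using half_weight_pos by (simp add: measure_def)
  qed
  finally show ?thesis .
qed

text \<open>The block has measure \<open>1 / 4\<close>. Hence a tensor product with
  \<open>half_kernel\<close> that vanishes almost everywhere forces the other factor to
  vanish.\<close>

lemma not_AE_half_kernel_zero: "\<not> (AE p in square_law. half_kernel p = 0)"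
proof
  assume "AE p in square_law. half_kernel p = 0"
  then have "(\<integral>p. half_kernel p \<partial>square_law) = 0"
    using integral_cong_AE[of half_kernel square_law "\<lambda>_. 0"] half_kernel_bounded_borel
    by (simp add: bounded_borel_def)
  also have "half_kernel = indicat_real ({..<1 / 2} \<times> {1 / 2..})"
    by (auto simp: half_kernel_def indicator_def fun_eq_iff)
  finally have "measure square_law ({..<1 / 2} \<times> {1 / 2..}) = 0" by simp
  moreover have "emeasure square_law ({..<1 / 2} \<times> {1 / 2..}) = ennreal (1 / 4)"
  proof -
    have "emeasure square_law ({..<1 / 2} \<times> {1 / 2..}) = ennreal (1 / 2) * ennreal (1 / 2)"
      using emeasure_square_law[of "{..<1 / 2}" "{1 / 2..}"] unfolding measure_unit_law_halves by simp
    also have "\<dots> = ennreal (1 / 2 * (1 / 2))" by (rule ennreal_mult[symmetric]) simp_all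
    finally show ?thesis by simp
  qed
  ultimately have "enn2real (ennreal (1 / 4)) = 0" unfolding measure_def by metis
  then show False by simp
qed

end

section \<open>Triangle inequalities for Borel kernels\<close>

definition subadditive_on ::
  "(real \<times> real \<Rightarrow> real) set \<Rightarrow> ((real \<times> real \<Rightarrow> real) \<Rightarrow> real) \<Rightarrow> bool" where
  "subadditive_on S N \<longleftrightarrow> (\<forall>f\<in>S. \<forall>g\<in>S. N (\<lambda>p. f p + g p) \<le> N f + N g)"

definition definite_on ::
  "(real \<times> real \<Rightarrow> real) set \<Rightarrow> ((real \<times> real \<Rightarrow> real) \<Rightarrow> real) \<Rightarrow> bool" where
  "definite_on S N \<longleftrightarrow> (\<forall>f\<in>S. N f = 0 \<longrightarrow> (AE p in square_law. f p = 0))"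

definition sym_kernel_class :: "bool \<Rightarrow> (real \<times> real \<Rightarrow> real) set" where
  "sym_kernel_class s = {f \<in> kernel_class s. flip f = f}"

lemma subadditive_onD:
  "subadditive_on S N \<Longrightarrow> f \<in> S \<Longrightarrow> g \<in> S \<Longrightarrow> N (\<lambda>p. f p + g p) \<le> N f + N g"
  by (simp add: subadditive_on_def)

lemma definite_onD: "definite_on S N \<Longrightarrow> f \<in> S \<Longrightarrow> N f = 0 \<Longrightarrow> AE p in square_law. f p = 0"
  by (simp add: definite_on_def)

context connected_bipartite_graph
begin

section \<open>The functionals to be compared\<close>

definition root_hom :: "(real \<times> real \<Rightarrow> real) \<Rightarrow> real" where
  "root_hom f = \<bar>hom1 f\<bar> powr (1 / real m)"

text \<open>The contribution of the two constant orientations to \<open>orient_max\<close>; under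
  the symmetric triangle inequality it turns out to be the whole maximum.\<close>

definition max_hom :: "(real \<times> real \<Rightarrow> real) \<Rightarrow> real" where
  "max_hom f = max \<bar>hom1 f\<bar> \<bar>hom1 (flip f)\<bar>"

definition root_max_hom :: "(real \<times> real \<Rightarrow> real) \<Rightarrow> real" where
  "root_max_hom f = max_hom f powr (1 / real m)"

text \<open>This is \<open>q_H\<close> for Borel kernels.\<close>

definition orient_max :: "(real \<times> real \<Rightarrow> real) \<Rightarrow> real" where
  "orient_max f = Max ((\<lambda>a. \<bar>hom (\<lambda>e. orient (a e) f)\<bar>) ` (E \<rightarrow>\<^sub>E {0, 1}))"

definition root_orient_max :: "(real \<times> real \<Rightarrow> real) \<Rightarrow> real" where
  "root_orient_max f = orient_max f powr (1 / real m)"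

lemma root_hom_nonneg: "0 \<le> root_hom f"
  and root_max_hom_nonneg: "0 \<le> root_max_hom f"
  by (simp_all add: root_hom_def root_max_hom_def)

lemma max_hom_nonneg: "0 \<le> max_hom f"
  by (simp add: max_hom_def)

lemma root_hom_power: "root_hom f ^ m = \<bar>hom1 f\<bar>"
  by (simp add: root_hom_def root_m_power)

lemma root_max_hom_power: "root_max_hom f ^ m = max_hom f"
  by (simp add: root_max_hom_def root_m_power max_hom_nonneg)

lemma hom1_cmult: "hom1 (\<lambda>p. c * f p) = c ^ m * hom1 f"
  using hom_cmult[of "\<lambda>_. c" "\<lambda>_. f"] by simp

lemma root_hom_cmult: "root_hom (\<lambda>p. c * f p) = \<bar>c\<bar> * root_hom f"
  by (simp add: root_hom_def hom1_cmult abs_mult power_abs powr_mult root_m_of_power)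

lemma hom1_zero: "hom1 (\<lambda>p. 0) = 0"
  using hom1_cmult[of 0 "\<lambda>p. 0"] by (simp add: power_0_left m_pos[THEN less_imp_neq, symmetric] del: card_eq_0_iff)

lemma finite_orientations: "finite (E \<rightarrow>\<^sub>E {0, 1 :: nat})" and orientations_ne: "E \<rightarrow>\<^sub>E {0, 1 :: nat} \<noteq> {}"
  using finite_E by (auto intro!: finite_PiE simp: PiE_eq_empty_iff)

lemma abs_hom_le_orient_max:
  assumes "a \<in> E \<rightarrow>\<^sub>E {0, 1}" shows "\<bar>hom (\<lambda>e. orient (a e) f)\<bar> \<le> orient_max f"
  unfolding orient_max_def using finite_orientations assms by (intro Max_ge) auto

lemma orient_max_le:
  assumes "\<And>a. a \<in> E \<rightarrow>\<^sub>E {0, 1} \<Longrightarrow> \<bar>hom (\<lambda>e. orient (a e) f)\<bar> \<le> C"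
  shows "orient_max f \<le> C"
  unfolding orient_max_def using finite_orientations orientations_ne assms
  by (subst Max_le_iff) auto

lemma hom_orient_constant:
  "hom (\<lambda>e. orient ((\<lambda>e\<in>E. 1) e) f) = hom1 f"
  "hom (\<lambda>e. orient ((\<lambda>e\<in>E. 0) e) f) = hom1 (flip f)"
  by (rule hom_cong, simp add: orient_def)+

lemma max_hom_le_orient_max: "max_hom f \<le> orient_max f"
proof -
  have "(\<lambda>e\<in>E. 1::nat) \<in> E \<rightarrow>\<^sub>E {0, 1}" "(\<lambda>e\<in>E. 0::nat) \<in> E \<rightarrow>\<^sub>E {0, 1}" by auto
  from this[THEN abs_hom_le_orient_max, of f] show ?thesis
    unfolding hom_orient_constant max_hom_def by simp
qed

lemma orient_max_nonneg: "0 \<le> orient_max f"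
  using max_hom_le_orient_max max_hom_nonneg order_trans by blast

text \<open>
  The function \<open>sym_block f\<close> is \<open>f\<close> placed in an off-diagonal block of the square, completed by
  its transpose to a symmetric function.
\<close>

definition sym_block :: "(real \<times> real \<Rightarrow> real) \<Rightarrow> real \<times> real \<Rightarrow> real" where
  "sym_block f p = tensor half_kernel f p + tensor (flip half_kernel) (flip f) p"

lemma flip_sym_block: "flip (sym_block f) = sym_block f"
proof -
  have "flip (sym_block f) = (\<lambda>p. flip (tensor half_kernel f) p + flip (tensor (flip half_kernel) (flip f)) p)"
    by (auto simp: sym_block_def flip_def)
  also have "\<dots> = sym_block f" by (auto simp: flip_tensor sym_block_def)
  finally show ?thesis .
qed

lemma sym_block_kernel_class: "f \<in> kernel_class s \<Longrightarrow> sym_block f \<in> kernel_class s"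
  unfolding sym_block_def by (intro kernel_class_intros)

text \<open>A filter on orientations: multiplicativity splits off the density of the half kernel,
  which is \<open>half_weight\<close> for a constant orientation and 0 otherwise.\<close>

lemma hom_tensor_half_kernel:
  assumes "\<And>e. e \<in> E \<Longrightarrow> F e \<in> bounded_borel"
  shows "hom (\<lambda>e. tensor (orient (a e) half_kernel) (F e)) =
    (if (\<forall>e\<in>E. a e = 1) \<or> (\<forall>e\<in>E. a e \<noteq> 1) then half_weight * hom F else 0)"
proof (cases "(\<forall>e\<in>E. a e = 1) \<or> (\<forall>e\<in>E. a e \<noteq> 1)")
  case True
  then show ?thesis
    using assms hom_half_kernel_constant[of a]
    by (simp add: hom_tensor orient_bounded_borel half_kernel_bounded_borel)
next
  case False
  then obtain e e' where "e \<in> E" "e' \<in> E" "a e = 1" "a e' \<noteq> 1" by auto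
  from hom_half_kernel_nonconstant[OF this] show ?thesis
    unfolding if_not_P[OF False] using assms
    by (subst hom_tensor) (simp_all add: orient_bounded_borel half_kernel_bounded_borel)
qed

text \<open>Expanding the two summands at each edge gives one term per orientation, and the half
  kernel removes all but the two constant ones.\<close>

lemma hom_sym_block:
  assumes F: "\<And>e. e \<in> E \<Longrightarrow> F e \<in> bounded_borel"
  shows "hom (\<lambda>e. sym_block (F e)) = half_weight * (hom F + hom (\<lambda>e. flip (F e)))"
proof -
  let ?c0 = "\<lambda>e\<in>E. 0::nat" and ?c1 = "\<lambda>e\<in>E. 1::nat"
  let ?h = "\<lambda>g. hom (\<lambda>e. tensor (orient (g e) half_kernel) (orient (g e) (F e)))"
  have "hom (\<lambda>e. sym_block (F e)) = hom (\<lambda>e p. \<Sum>i\<in>{0, 1::nat}. tensor (orient i half_kernel) (orient i (F e)) p)"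
    by (rule hom_cong) (auto simp: sym_block_def orient_def)
  also have "\<dots> = (\<Sum>g\<in>E \<rightarrow>\<^sub>E {0, 1}. ?h g)"
    using F by (intro hom_sum) (auto intro!: tensor_bounded_borel orient_bounded_borel half_kernel_bounded_borel)
  also have "\<dots> = (\<Sum>g\<in>{?c0, ?c1}. ?h g)"
  proof (rule sum.mono_neutral_right[OF finite_orientations])
    show "\<forall>g\<in>(E \<rightarrow>\<^sub>E {0, 1}) - {?c0, ?c1}. ?h g = 0"
    proof
      fix g assume g: "g \<in> (E \<rightarrow>\<^sub>E {0, 1}) - {?c0, ?c1}"
      have "\<not> (\<forall>e\<in>E. g e = 1)"
      proof
        assume "\<forall>e\<in>E. g e = 1"
        then have "g = ?c1" using g by (intro extensionalityI[of _ E]) (auto simp: PiE_def)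
        then show False using g by simp
      qed
      moreover have "\<not> (\<forall>e\<in>E. g e \<noteq> 1)"
      proof
        assume "\<forall>e\<in>E. g e \<noteq> 1"
        then have "g = ?c0" using g by (intro extensionalityI[of _ E]) (auto simp: PiE_def Pi_def)
        then show False using g by simp
      qed
      ultimately show "?h g = 0"
        using hom_tensor_half_kernel[of "\<lambda>e. orient (g e) (F e)" g] F by (auto simp: orient_bounded_borel)
    qed
  qed auto
  also have "\<dots> = ?h ?c0 + ?h ?c1"
  proof -
    obtain e where "e \<in> E" using E_ne by auto
    then have "?c0 \<noteq> ?c1" by (metis restrict_apply' zero_neq_one)
    then show ?thesis by simp
  qed
  also have "?h ?c0 = half_weight * hom (\<lambda>e. flip (F e))"
    using hom_tensor_half_kernel[of "\<lambda>e. orient (?c0 e) (F e)" ?c0] F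
    by (simp add: orient_bounded_borel) (auto intro!: hom_cong simp: orient_def)
  also have "?h ?c1 = half_weight * hom F"
    using hom_tensor_half_kernel[of "\<lambda>e. orient (?c1 e) (F e)" ?c1] F
    by (simp add: orient_bounded_borel) (auto intro!: hom_cong simp: orient_def)
  finally show ?thesis by (simp add: algebra_simps)
qed

text \<open>The half kernel removes every nonconstant orientation from the maximum, so
  \<open>max_hom\<close> is visible in \<open>orient_max\<close> without any norming
  hypothesis.\<close>

lemma orient_max_tensor_half_kernel:
  assumes f: "f \<in> bounded_borel"
  shows "orient_max (tensor half_kernel f) = half_weight * max_hom f"
proof (rule antisym)
  show "orient_max (tensor half_kernel f) \<le> half_weight * max_hom f"
  proof (rule orient_max_le)
    fix a :: "'v \<times> 'v \<Rightarrow> nat" assume "a \<in> E \<rightarrow>\<^sub>E {0, 1}"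
    have eq: "hom (\<lambda>e. orient (a e) (tensor half_kernel f)) =
      (if (\<forall>e\<in>E. a e = 1) \<or> (\<forall>e\<in>E. a e \<noteq> 1) then half_weight * hom (\<lambda>e. orient (a e) f) else 0)"
      unfolding orient_tensor using f by (intro hom_tensor_half_kernel) (simp add: orient_bounded_borel)
    show "\<bar>hom (\<lambda>e. orient (a e) (tensor half_kernel f))\<bar> \<le> half_weight * max_hom f"
    proof (cases "(\<forall>e\<in>E. a e = 1) \<or> (\<forall>e\<in>E. a e \<noteq> 1)")
      case True
      then have "hom (\<lambda>e. orient (a e) f) = hom1 f \<or> hom (\<lambda>e. orient (a e) f) = hom1 (flip f)"
        by (auto intro!: hom_cong simp: orient_def)
      then have "\<bar>hom (\<lambda>e. orient (a e) f)\<bar> \<le> max_hom f" by (auto simp: max_hom_def)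
      then show ?thesis unfolding eq using True half_weight_pos by (simp add: abs_mult)
    next
      case False
      then show ?thesis unfolding eq using max_hom_nonneg half_weight_pos by auto
    qed
  qed
  have "hom1 (tensor half_kernel f) = half_weight * hom1 f"
    using hom_tensor_half_kernel[of "\<lambda>_. f" "\<lambda>_. 1"] f by (simp add: orient_def)
  moreover have "hom1 (flip (tensor half_kernel f)) = half_weight * hom1 (flip f)"
    using hom_tensor_half_kernel[of "\<lambda>_. flip f" "\<lambda>_. 0"] f
    by (simp add: orient_def flip_tensor flip_bounded_borel)
  ultimately have "max_hom (tensor half_kernel f) = half_weight * max_hom f"
    using half_weight_pos by (simp add: max_hom_def abs_mult max_def)
  then show "half_weight * max_hom f \<le> orient_max (tensor half_kernel f)"
    using max_hom_le_orient_max[of "tensor half_kernel f"] by simp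
qed

section \<open>From symmetric kernels to the maximum over orientations\<close>

lemma root_hom_sum:
  assumes sub: "subadditive_on (sym_kernel_class s) root_hom"
    and I: "finite I" and f: "\<And>i. i \<in> I \<Longrightarrow> f i \<in> kernel_class s" "\<And>i. i \<in> I \<Longrightarrow> flip (f i) = f i"
  shows "root_hom (\<lambda>p. \<Sum>i\<in>I. f i p) \<le> (\<Sum>i\<in>I. root_hom (f i))"
  using I f
proof (induction I rule: finite_induct)
  case empty
  then show ?case by (simp add: root_hom_def hom1_zero)
next
  case (insert i I)
  have "flip (\<lambda>p. \<Sum>i\<in>I. f i p) = (\<lambda>p. \<Sum>i\<in>I. flip (f i) p)" by (simp add: flip_def fun_eq_iff)
  also have "\<dots> = (\<lambda>p. \<Sum>i\<in>I. f i p)" using insert by (intro ext sum.cong) auto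
  finally have "root_hom (\<lambda>p. f i p + (\<Sum>i\<in>I. f i p)) \<le> root_hom (f i) + root_hom (\<lambda>p. \<Sum>i\<in>I. f i p)"
    using insert by (intro subadditive_onD[OF sub]) (auto simp: sym_kernel_class_def intro: kernel_class_sum)
  then show ?case using insert by simp
qed

text \<open>
  Expanding \<open>hom1\<close> of the sum of the tensor powers produces even powers of homomorphism densities,
  one of which is the wanted one, while the triangle inequality bounds the sum independently of
  the exponent.
\<close>

lemma abs_hom_le_1:
  assumes sub: "subadditive_on (sym_kernel_class s) root_hom"
    and F: "\<And>e. e \<in> E \<Longrightarrow> F e \<in> kernel_class s" "\<And>e. e \<in> E \<Longrightarrow> flip (F e) = F e"
    and le: "\<And>e. e \<in> E \<Longrightarrow> root_hom (F e) \<le> 1"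
  shows "\<bar>hom F\<bar> \<le> 1"
proof (rule le_of_pow_two_powers)
  fix k
  let ?K = "2 ^ Suc k :: nat"
  let ?f = "\<lambda>p. \<Sum>i\<in>E. tensor_power (F i) (Suc k) p"
  have even: "even ?K" by simp
  have Fb: "F e \<in> bounded_borel" if "e \<in> E" for e using F(1)[OF that] by (rule kernel_class_bounded_borel)
  have le1: "root_hom (tensor_power (F i) (Suc k)) \<le> 1" if i: "i \<in> E" for i
  proof -
    have "hom1 (tensor_power (F i) (Suc k)) = hom1 (F i) ^ ?K"
      using Fb[OF i] by (rule hom_tensor_power)
    then have "root_hom (tensor_power (F i) (Suc k)) = root_hom (F i) ^ ?K"
      unfolding root_hom_def by (simp only: power_abs power_powr_commute[OF abs_ge_zero] zero_less_power zero_less_numeral)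
    then show ?thesis using le[OF i] root_hom_nonneg by (simp only: power_le_one)
  qed
  have "hom1 ?f = (\<Sum>g\<in>E \<rightarrow>\<^sub>E E. hom (\<lambda>e. tensor_power (F (g e)) (Suc k)))"
    using finite_E Fb by (intro hom_sum) (auto intro: tensor_power_bounded_borel simp del: tensor_power.simps)
  also have "\<dots> = (\<Sum>g\<in>E \<rightarrow>\<^sub>E E. hom (\<lambda>e. F (g e)) ^ ?K)"
    using Fb by (intro sum.cong refl hom_tensor_power) (blast dest: PiE_mem)
  finally have expand: "hom1 ?f = (\<Sum>g\<in>E \<rightarrow>\<^sub>E E. hom (\<lambda>e. F (g e)) ^ ?K)" .
  have "hom F = hom (\<lambda>e. F ((\<lambda>e\<in>E. e) e))" by (rule hom_cong) simp
  then have "\<bar>hom F\<bar> ^ ?K = hom (\<lambda>e. F ((\<lambda>e\<in>E. e) e)) ^ ?K"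
    using even by (simp only: power_even_abs)
  also have "\<dots> \<le> hom1 ?f"
    unfolding expand
  proof (rule member_le_sum)
    show "finite (E \<rightarrow>\<^sub>E E)" using finite_E by (intro finite_PiE) auto
  qed (use even in \<open>auto simp: zero_le_even_power simp del: power_Suc\<close>)
  also have "\<dots> \<le> root_hom ?f ^ m" by (simp add: root_hom_power)
  also have "\<dots> \<le> real m ^ m"
  proof (rule power_mono)
    have "root_hom ?f \<le> (\<Sum>i\<in>E. root_hom (tensor_power (F i) (Suc k)))"
      using F finite_E
      by (intro root_hom_sum[OF sub]) (auto simp del: tensor_power.simps simp: kernel_class_tensor_power flip_tensor_power)
    also have "\<dots> \<le> (\<Sum>i\<in>E. 1)" using le1 by (rule sum_mono)
    finally show "root_hom ?f \<le> real m" by simp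
  qed (rule root_hom_nonneg)
  finally show "\<bar>hom F\<bar> ^ ?K \<le> real m ^ m * 1 ^ ?K" by simp
qed auto

text \<open>Homogeneity reduces this to the normalised case. Since some
  \<open>root_hom (F e)\<close> may be 0, each kernel is divided by a slightly larger positive
  number, and the excess then tends to 0.\<close>

lemma abs_hom_le_prod_root_hom:
  assumes sub: "subadditive_on (sym_kernel_class s) root_hom"
    and F: "\<And>e. e \<in> E \<Longrightarrow> F e \<in> kernel_class s" "\<And>e. e \<in> E \<Longrightarrow> flip (F e) = F e"
  shows "\<bar>hom F\<bar> \<le> (\<Prod>e\<in>E. root_hom (F e))"
proof (rule LIMSEQ_le_const)
  show "(\<lambda>n. \<Prod>e\<in>E. root_hom (F e) + inverse (real (Suc n))) \<longlonglongrightarrow> (\<Prod>e\<in>E. root_hom (F e))"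
    by (intro tendsto_prod LIMSEQ_inverse_real_of_nat_add)
  have "\<bar>hom F\<bar> \<le> (\<Prod>e\<in>E. root_hom (F e) + inverse (real (Suc n)))" for n
  proof -
    define c where "c e = root_hom (F e) + inverse (real (Suc n))" for e
    have c: "0 < c e" for e unfolding c_def using root_hom_nonneg[of "F e"] by (simp add: add_nonneg_pos)
    have "\<bar>hom (\<lambda>e p. inverse (c e) * F e p)\<bar> \<le> 1"
    proof (rule abs_hom_le_1[OF sub])
      fix e assume e: "e \<in> E"
      show "(\<lambda>p. inverse (c e) * F e p) \<in> kernel_class s"
        using F(1)[OF e] c[of e] by (intro kernel_class_intros) auto
      show "flip (\<lambda>p. inverse (c e) * F e p) = (\<lambda>p. inverse (c e) * F e p)"
        using F(2)[OF e] by (simp add: flip_def fun_eq_iff)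
      have "root_hom (F e) \<le> c e" by (simp add: c_def)
      then show "root_hom (\<lambda>p. inverse (c e) * F e p) \<le> 1"
        unfolding root_hom_cmult using c[of e] by (simp add: field_simps)
    qed
    then have "inverse (\<Prod>e\<in>E. c e) * \<bar>hom F\<bar> \<le> 1"
      unfolding hom_cmult abs_mult prod_inversef[symmetric] using c
      by (simp add: abs_prod abs_of_pos comp_def)
    moreover have "0 < (\<Prod>e\<in>E. c e)" using c by (intro prod_pos) auto
    ultimately show ?thesis by (simp add: c_def field_simps)
  qed
  then show "\<exists>N. \<forall>n\<ge>N. \<bar>hom F\<bar> \<le> (\<Prod>e\<in>E. root_hom (F e) + inverse (real (Suc n)))" by blast
qed

text \<open>The available Hoelder inequality is for symmetric kernels, so it is applied to
  symmetrised blocks of tensor powers of the oriented kernels. Their density contains an even power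
  of the wanted one, and the constants are lost as the exponent grows.\<close>

lemma abs_hom_orient_le_prod_root_max_hom:
  assumes sub: "subadditive_on (sym_kernel_class s) root_hom"
    and F: "\<And>e. e \<in> E \<Longrightarrow> F e \<in> kernel_class s"
  shows "\<bar>hom (\<lambda>e. orient (a e) (F e))\<bar> \<le> (\<Prod>e\<in>E. root_max_hom (F e))"
proof (rule le_of_pow_two_powers)
  fix k
  let ?K = "2 ^ Suc k :: nat"
  let ?G = "\<lambda>e. orient (a e) (F e)"
  let ?S = "\<lambda>e. sym_block (tensor_power (?G e) (Suc k))"
  have K: "even ?K" "0 < ?K" by simp_all
  have Gc: "?G e \<in> kernel_class s" if "e \<in> E" for e using F[OF that] by (rule kernel_class_intros)
  have Gb: "?G e \<in> bounded_borel" if "e \<in> E" for e using Gc[OF that] by (rule kernel_class_bounded_borel)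
  have hom_block: "hom (\<lambda>e. sym_block (tensor_power (F e) (Suc k)))
      = half_weight * (hom F ^ ?K + hom (\<lambda>e. flip (F e)) ^ ?K)"
    if "\<And>e. e \<in> E \<Longrightarrow> F e \<in> bounded_borel" for F
  proof -
    have "hom (\<lambda>e. flip (tensor_power (F e) (Suc k))) = hom (\<lambda>e. flip (F e)) ^ ?K"
      unfolding flip_tensor_power using that by (intro hom_tensor_power flip_bounded_borel)
    moreover have "hom (\<lambda>e. tensor_power (F e) (Suc k)) = hom F ^ ?K"
      using that by (intro hom_tensor_power)
    ultimately show ?thesis
      using hom_sym_block[of "\<lambda>e. tensor_power (F e) (Suc k)"] that by (metis tensor_power_bounded_borel)
  qed
  \<comment> \<open>Both densities in a block are at most \<open>max_hom (F e)\<close>, which is the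
    same for either orientation; the two terms give the factor 2.\<close>
  have root_block: "root_hom (?S e) \<le> (2 * half_weight) powr (1 / real m) * root_max_hom (F e) ^ ?K" if e: "e \<in> E" for e
  proof -
    have le: "\<bar>hom1 (?G e)\<bar> \<le> max_hom (F e)" "\<bar>hom1 (flip (?G e))\<bar> \<le> max_hom (F e)"
      by (auto simp: max_hom_def orient_def)
    have "\<bar>hom1 (?S e)\<bar> = half_weight * (\<bar>hom1 (?G e)\<bar> ^ ?K + \<bar>hom1 (flip (?G e))\<bar> ^ ?K)"
      using hom_block[of "\<lambda>_. ?G e"] Gb[OF e] half_weight_pos K(1)
      by (simp only: abs_mult power_even_abs abs_of_pos abs_of_nonneg zero_le_even_power add_nonneg_nonneg)
    also have "\<dots> \<le> half_weight * (max_hom (F e) ^ ?K + max_hom (F e) ^ ?K)"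
      using half_weight_pos le by (intro mult_left_mono add_mono power_mono) auto
    also have "\<dots> = (2 * half_weight) * max_hom (F e) ^ ?K" by (simp add: algebra_simps)
    finally have "root_hom (?S e) \<le> ((2 * half_weight) * max_hom (F e) ^ ?K) powr (1 / real m)"
      unfolding root_hom_def by (intro powr_mono2) auto
    also have "\<dots> = (2 * half_weight) powr (1 / real m) * root_max_hom (F e) ^ ?K"
      unfolding root_max_hom_def using half_weight_pos K max_hom_nonneg[of "F e"]
      by (simp only: powr_mult power_powr_commute)
    finally show ?thesis .
  qed
  \<comment> \<open>The transposed term is an even power, hence nonnegative, so it may be
    added.\<close>
  have "half_weight * \<bar>hom ?G\<bar> ^ ?K \<le> half_weight * (hom ?G ^ ?K + hom (\<lambda>e. flip (?G e)) ^ ?K)"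
    using half_weight_pos K by (intro mult_left_mono) (simp_all only: power_even_abs zero_le_even_power le_add_same_cancel1 less_imp_le)
  also have "\<dots> = hom ?S" using hom_block[of ?G] Gb by simp
  also have "\<dots> \<le> \<bar>hom ?S\<bar>" by simp
  also have "\<dots> \<le> (\<Prod>e\<in>E. root_hom (?S e))"
    using Gc by (intro abs_hom_le_prod_root_hom[OF sub] sym_block_kernel_class kernel_class_tensor_power flip_sym_block)
  also have "\<dots> \<le> (\<Prod>e\<in>E. (2 * half_weight) powr (1 / real m) * root_max_hom (F e) ^ ?K)"
    using root_block root_hom_nonneg by (intro prod_mono) auto
  also have "\<dots> = ((2 * half_weight) powr (1 / real m)) ^ m * (\<Prod>e\<in>E. root_max_hom (F e)) ^ ?K"
    unfolding prod.distrib prod_constant prod_power_distrib ..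
  \<comment> \<open>The \<open>m\<close> equal constants multiply to \<open>2 * half_weight\<close>;
    cancelling \<open>half_weight\<close> leaves a factor 2 independent of \<open>k\<close>.\<close>
  also have "((2 * half_weight) powr (1 / real m)) ^ m = half_weight * 2"
    using half_weight_pos by (subst root_m_power) simp_all
  finally show "\<bar>hom ?G\<bar> ^ ?K \<le> 2 * (\<Prod>e\<in>E. root_max_hom (F e)) ^ ?K"
    using half_weight_pos by (simp only: mult.assoc mult_le_cancel_left_pos)
qed (auto intro: prod_nonneg root_max_hom_nonneg)

text \<open>With one kernel on all edges the product bound becomes
  \<open>root_max_hom f ^ m\<close>, which is \<open>max_hom f\<close>.\<close>

lemma orient_max_eq_max_hom:
  assumes sub: "subadditive_on (sym_kernel_class s) root_hom"
    and f: "f \<in> kernel_class s"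
  shows "orient_max f = max_hom f"
proof (rule antisym[OF orient_max_le max_hom_le_orient_max])
  fix a :: "'v \<times> 'v \<Rightarrow> nat"
  show "\<bar>hom (\<lambda>e. orient (a e) f)\<bar> \<le> max_hom f"
    using abs_hom_orient_le_prod_root_max_hom[OF sub, of "\<lambda>_. f" a] f by (simp add: root_max_hom_power)
qed

text \<open>The density of the sum is expanded over the choices of \<open>f\<close> or
  \<open>g\<close> at each edge, every term is bounded by the decorated inequality, and the bounds
  recombine into the \<open>m\<close>-th power of a sum.\<close>

lemma root_orient_max_subadditive:
  assumes sub: "subadditive_on (sym_kernel_class s) root_hom"
  shows "subadditive_on (kernel_class s) root_orient_max"
  unfolding subadditive_on_def
proof (intro ballI)
  fix f g assume f: "f \<in> kernel_class s" and g: "g \<in> kernel_class s"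
  show "root_orient_max (\<lambda>p. f p + g p) \<le> root_orient_max f + root_orient_max g"
  proof -
    have eq: "root_orient_max h = root_max_hom h" if "h \<in> kernel_class s" for h
      using orient_max_eq_max_hom[OF sub that] by (simp add: root_orient_max_def root_max_hom_def)
    let ?h = "\<lambda>i. if i = (0 :: nat) then f else g"
    have h: "?h i \<in> kernel_class s" for i :: nat using f g by simp
    have "orient_max (\<lambda>p. f p + g p) \<le> (root_max_hom f + root_max_hom g) ^ m"
    proof (rule orient_max_le)
      fix a :: "'v \<times> 'v \<Rightarrow> nat"
      have "hom (\<lambda>e. orient (a e) (\<lambda>p. f p + g p)) = hom (\<lambda>e p. \<Sum>i\<in>{0, 1::nat}. orient (a e) (?h i) p)"
        by (simp add: orient_add)
      also have "\<dots> = (\<Sum>j\<in>E \<rightarrow>\<^sub>E {0, 1}. hom (\<lambda>e. orient (a e) (?h (j e))))"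
        using h by (intro hom_sum[of "{0, 1}" "\<lambda>e i. orient (a e) (?h i)"] orient_bounded_borel kernel_class_bounded_borel[of _ s]) auto
      finally have "\<bar>hom (\<lambda>e. orient (a e) (\<lambda>p. f p + g p))\<bar> \<le> (\<Sum>j\<in>E \<rightarrow>\<^sub>E {0, 1}. \<bar>hom (\<lambda>e. orient (a e) (?h (j e)))\<bar>)"
        by simp
      also have "\<dots> \<le> (\<Sum>j\<in>E \<rightarrow>\<^sub>E {0, 1}. \<Prod>e\<in>E. root_max_hom (?h (j e)))"
        using h by (intro sum_mono abs_hom_orient_le_prod_root_max_hom[OF sub])
      also have "\<dots> = (\<Prod>e\<in>E. \<Sum>i\<in>{0, 1::nat}. root_max_hom (?h i))"
        using finite_E by (subst prod_sum_PiE) auto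
      also have "\<dots> = (root_max_hom f + root_max_hom g) ^ m" by simp
      finally show "\<bar>hom (\<lambda>e. orient (a e) (\<lambda>p. f p + g p))\<bar> \<le> (root_max_hom f + root_max_hom g) ^ m" .
    qed
    then have "root_orient_max (\<lambda>p. f p + g p) \<le> ((root_max_hom f + root_max_hom g) ^ m) powr (1 / real m)"
      unfolding root_orient_max_def using orient_max_nonneg by (intro powr_mono2) auto
    also have "\<dots> = root_max_hom f + root_max_hom g"
      by (intro root_m_of_power add_nonneg_nonneg root_max_hom_nonneg)
    finally show ?thesis by (simp add: eq f g)
  qed
qed

text \<open>If the maximum vanishes, so does the density of the symmetric function
  \<open>sym_block f\<close>, to which symmetric definiteness applies.\<close>

lemma root_orient_max_definite:
  assumes definite: "definite_on (sym_kernel_class s) root_hom"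
  shows "definite_on (kernel_class s) root_orient_max"
  unfolding definite_on_def
proof (intro ballI impI)
  fix f assume f: "f \<in> kernel_class s" and zero: "root_orient_max f = 0"
  have fb: "f \<in> bounded_borel" using f by (rule kernel_class_bounded_borel)
  have "max_hom f = 0"
    using zero max_hom_le_orient_max[of f] max_hom_nonneg[of f] by (simp add: root_orient_max_def)
  then have "hom1 f = 0" "hom1 (flip f) = 0" by (auto simp: max_hom_def max_def split: if_splits)
  then have "hom1 (sym_block f) = 0"
    using hom_sym_block[of "\<lambda>_. f"] fb by simp
  then have "AE p in square_law. sym_block f p = 0"
    by (intro definite_onD[OF definite]) (simp_all add: root_hom_def sym_kernel_class_def sym_block_kernel_class f flip_sym_block)
  \<comment> \<open>The two summands of the block have disjoint supports, so they cannot
    cancel.\<close>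
  then have "AE p in square_law. tensor half_kernel f p = 0"
    by eventually_elim (auto simp: sym_block_def tensor_def half_kernel_def flip_def split: if_splits)
  then show "AE p in square_law. f p = 0"
    using AE_tensor_zero[OF half_kernel_bounded_borel fb] not_AE_half_kernel_zero by blast
qed

section \<open>From the maximum back to the density itself\<close>

lemma root_max_hom_subadditive:
  assumes sub: "subadditive_on (kernel_class s) root_orient_max"
  shows "subadditive_on (kernel_class s) root_max_hom"
  unfolding subadditive_on_def
proof (intro ballI)
  fix f g assume f: "f \<in> kernel_class s" and g: "g \<in> kernel_class s"
  show "root_max_hom (\<lambda>p. f p + g p) \<le> root_max_hom f + root_max_hom g"
  proof -
    let ?c = "half_weight powr (1 / real m)"
    \<comment> \<open>Tensoring with the half kernel is linear and turns
      \<open>root_orient_max\<close> into a positive multiple of \<open>root_max_hom\<close>, so the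
      triangle inequality is inherited.\<close>
    have eq: "root_orient_max (tensor half_kernel h) = ?c * root_max_hom h" if "h \<in> kernel_class s" for h
      using orient_max_tensor_half_kernel[OF kernel_class_bounded_borel[OF that]] half_weight_pos max_hom_nonneg[of h]
      by (simp add: root_orient_max_def root_max_hom_def powr_mult)
    have "tensor half_kernel (\<lambda>p. f p + g p) = (\<lambda>p. tensor half_kernel f p + tensor half_kernel g p)"
      by (auto simp: tensor_def algebra_simps)
    then have "root_orient_max (tensor half_kernel (\<lambda>p. f p + g p))
        \<le> root_orient_max (tensor half_kernel f) + root_orient_max (tensor half_kernel g)"
      using subadditive_onD[OF sub, of "tensor half_kernel f" "tensor half_kernel g"] f g
      by (simp add: kernel_class_intros)
    then have "?c * root_max_hom (\<lambda>p. f p + g p) \<le> ?c * root_max_hom f + ?c * root_max_hom g"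
      using f g by (simp only: eq kernel_class_intros)
    then show ?thesis
      using half_weight_pos by (simp flip: distrib_left)
  qed
qed

text \<open>
  If \<open>max_hom\<close> differs from \<open>\<bar>hom1\<bar>\<close>, some \<open>h\<close> has a density exceeding that of its transpose;
  tensoring with high powers of \<open>h\<close> and renormalising suppresses the second term of the maximum.
\<close>

lemma root_hom_subadditive:
  assumes sub: "subadditive_on (kernel_class s) root_max_hom"
  shows "subadditive_on (kernel_class s) root_hom"
  unfolding subadditive_on_def
proof (intro ballI)
  fix f g assume f: "f \<in> kernel_class s" and g: "g \<in> kernel_class s"
  show "root_hom (\<lambda>p. f p + g p) \<le> root_hom f + root_hom g"
  proof (cases "\<forall>h\<in>kernel_class s. \<bar>hom1 (flip h)\<bar> \<le> \<bar>hom1 h\<bar>")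
    case True
    then have "root_max_hom h = root_hom h" if "h \<in> kernel_class s" for h
      using that by (simp add: root_max_hom_def root_hom_def max_hom_def max_absorb1)
    then show ?thesis using subadditive_onD[OF sub f g] f g by (simp add: kernel_class_intros)
  next
    case False
    then obtain h' where h': "h' \<in> kernel_class s" "\<bar>hom1 h'\<bar> < \<bar>hom1 (flip h')\<bar>" by auto
    define h where "h = flip h'"
    have h: "h \<in> kernel_class s" "\<bar>hom1 (flip h)\<bar> < \<bar>hom1 h\<bar>"
      using h' by (auto simp: h_def kernel_class_intros)
    define x where "x = \<bar>hom1 h\<bar>"
    define r where "r = \<bar>hom1 (flip h)\<bar> / x"
    have x: "0 < x" using h(2) by (simp add: x_def)
    have r: "0 \<le> r" "r < 1" using h(2) x by (auto simp: r_def x_def)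
    \<comment> \<open>\<open>N k u\<close> is \<open>root_max_hom\<close> of \<open>u\<close>
      tensored with \<open>tensor_power h k\<close>, divided by the root of the density
      \<open>x ^ 2 ^ k\<close> of that power; the factor \<open>r < 1\<close> damps the transposed
      density.\<close>
    define N where "N k u = max \<bar>hom1 u\<bar> (r ^ 2 ^ k * \<bar>hom1 (flip u)\<bar>) powr (1 / real m)" for k u
    have tensor_h: "root_max_hom (tensor u (tensor_power h k)) = (x ^ 2 ^ k) powr (1 / real m) * N k u"
      if u: "u \<in> kernel_class s" for u k
    proof -
      note b = kernel_class_bounded_borel[OF u] kernel_class_bounded_borel[OF h(1)]
      have "\<bar>hom1 (tensor u (tensor_power h k))\<bar> = x ^ 2 ^ k * \<bar>hom1 u\<bar>"
        using hom_tensor[of "\<lambda>_. u" "\<lambda>_. tensor_power h k"] hom_tensor_power[of "\<lambda>_. h" k] b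
        by (simp add: tensor_power_bounded_borel abs_mult power_abs x_def mult.commute)
      moreover have "\<bar>hom1 (flip (tensor u (tensor_power h k)))\<bar> = x ^ 2 ^ k * (r ^ 2 ^ k * \<bar>hom1 (flip u)\<bar>)"
      proof -
        have "\<bar>hom1 (flip (tensor u (tensor_power h k)))\<bar> = \<bar>hom1 (flip h)\<bar> ^ 2 ^ k * \<bar>hom1 (flip u)\<bar>"
          using hom_tensor[of "\<lambda>_. flip u" "\<lambda>_. tensor_power (flip h) k"] hom_tensor_power[of "\<lambda>_. flip h" k] b
          by (simp add: flip_tensor flip_tensor_power flip_bounded_borel tensor_power_bounded_borel abs_mult power_abs mult.commute)
        also have "\<bar>hom1 (flip h)\<bar> = x * r" using x by (simp add: r_def)
        finally show ?thesis by (simp add: power_mult_distrib)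
      qed
      moreover have "max (c * a) (c * b) = c * max a b" if "0 \<le> c" for a b c :: real
        using that max_mult_distrib_left[of c a b] by auto
      ultimately have "max_hom (tensor u (tensor_power h k)) = x ^ 2 ^ k * max \<bar>hom1 u\<bar> (r ^ 2 ^ k * \<bar>hom1 (flip u)\<bar>)"
        using x by (simp add: max_hom_def)
      then show ?thesis
        using x by (simp add: root_max_hom_def N_def powr_mult)
    qed
    have le: "root_hom (\<lambda>p. f p + g p) \<le> N k f + N k g" for k
    proof -
      let ?c = "(x ^ 2 ^ k) powr (1 / real m)"
      have "tensor (\<lambda>p. f p + g p) (tensor_power h k) = (\<lambda>p. tensor f (tensor_power h k) p + tensor g (tensor_power h k) p)"
        by (auto simp: tensor_def algebra_simps)
      then have "root_max_hom (tensor (\<lambda>p. f p + g p) (tensor_power h k))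
          \<le> root_max_hom (tensor f (tensor_power h k)) + root_max_hom (tensor g (tensor_power h k))"
        using subadditive_onD[OF sub, of "tensor f (tensor_power h k)" "tensor g (tensor_power h k)"] f g h
        by (simp add: kernel_class_intros kernel_class_tensor_power)
      then have "?c * N k (\<lambda>p. f p + g p) \<le> ?c * N k f + ?c * N k g"
        using f g by (simp only: tensor_h kernel_class_intros)
      then have "N k (\<lambda>p. f p + g p) \<le> N k f + N k g"
        using x by (simp flip: distrib_left)
      \<comment> \<open>A maximum bounds its first argument, so only the right-hand side has to be
        passed to the limit.\<close>
      moreover have "root_hom (\<lambda>p. f p + g p) \<le> N k (\<lambda>p. f p + g p)"
        unfolding root_hom_def N_def by (intro powr_mono2) auto
      ultimately show ?thesis by simp
    qed
    have lim: "(\<lambda>k. N k u) \<longlonglongrightarrow> root_hom u" for u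
    proof -
      have "(\<lambda>k. r ^ 2 ^ k) \<longlonglongrightarrow> 0"
      proof (rule filterlim_compose[OF LIMSEQ_power_zero])
        show "filterlim (\<lambda>k. 2 ^ k :: nat) sequentially sequentially"
          by (rule filterlim_subseq) (simp add: strict_mono_def)
      qed (use r in simp)
      then have "(\<lambda>k. max \<bar>hom1 u\<bar> (r ^ 2 ^ k * \<bar>hom1 (flip u)\<bar>)) \<longlonglongrightarrow> max \<bar>hom1 u\<bar> (0 * \<bar>hom1 (flip u)\<bar>)"
        by (intro tendsto_intros)
      then have "(\<lambda>k. N k u) \<longlonglongrightarrow> max \<bar>hom1 u\<bar> (0 * \<bar>hom1 (flip u)\<bar>) powr (1 / real m)"
        unfolding N_def using m_pos by (intro tendsto_powr' tendsto_const) auto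
      then show ?thesis by (simp add: root_hom_def)
    qed
    show ?thesis
      by (rule LIMSEQ_le_const[OF tendsto_add[OF lim lim]]) (use le in blast)
  qed
qed

text \<open>Only \<open>hom1 f\<close> is known to vanish. Tensoring with the transpose gives a
  kernel whose density and transposed density both contain this factor, and the half kernel turns
  this into a vanishing \<open>root_orient_max\<close>.\<close>

lemma root_hom_definite:
  assumes definite: "definite_on (kernel_class s) root_orient_max"
  shows "definite_on (kernel_class s) root_hom"
  unfolding definite_on_def
proof (intro ballI impI)
  fix f assume f: "f \<in> kernel_class s" and zero: "root_hom f = 0"
  let ?g = "tensor f (flip f)"
  have fb: "f \<in> bounded_borel" using f by (rule kernel_class_bounded_borel)
  have g: "?g \<in> kernel_class s" using f by (intro kernel_class_intros)
  have "hom1 f = 0" using zero by (simp add: root_hom_def)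
  then have "max_hom ?g = 0"
    using hom_tensor[of "\<lambda>_. f" "\<lambda>_. flip f"] hom_tensor[of "\<lambda>_. flip f" "\<lambda>_. f"] fb
    by (simp add: max_hom_def flip_tensor flip_bounded_borel)
  then have "root_orient_max (tensor half_kernel ?g) = 0"
    using orient_max_tensor_half_kernel[OF kernel_class_bounded_borel[OF g]] by (simp add: root_orient_max_def)
  then have "AE p in square_law. tensor half_kernel ?g p = 0"
    using g by (intro definite_onD[OF definite]) (simp_all add: kernel_class_intros)
  then have "AE p in square_law. ?g p = 0"
    using AE_tensor_zero[OF half_kernel_bounded_borel kernel_class_bounded_borel[OF g]] not_AE_half_kernel_zero by blast
  then show "AE p in square_law. f p = 0"
    using AE_tensor_zero[OF fb flip_bounded_borel[OF fb]] AE_flip_zero[OF fb] by blast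
qed

end

section \<open>Transfer to Lebesgue measurable functions\<close>

lemma square_law_eq_density: "square_law = density lborel (indicator unit_square)"
proof -
  interpret L: prob_space unit_law by (rule prob_space_unit_law)
  have "unit_law \<Otimes>\<^sub>M unit_law = density lborel (indicator unit_square)"
  proof (rule pair_measure_eqI)
    show "sets (unit_law \<Otimes>\<^sub>M unit_law) = sets (density lborel (indicator unit_square))"
      by (metis square_law_eq sets_distr sets_density sets_lborel)
    fix X Y assume "X \<in> sets unit_law" "Y \<in> sets unit_law"
    then have XY: "X \<in> sets borel" "Y \<in> sets borel" by auto
    have S: "unit_square \<in> sets borel" by (simp add: borel_Times)
    have law: "emeasure unit_law Z = emeasure lborel (Z \<inter> {0..1})" if "Z \<in> sets borel" for Z
      using that by (simp add: emeasure_distr space_restrict_space emeasure_restrict_space)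
    have "emeasure (density lborel (indicator unit_square)) (X \<times> Y) = emeasure lborel (unit_square \<inter> X \<times> Y)"
      using S borel_Times[OF XY] by (subst emeasure_density) (simp_all add: indicator_inter_arith[symmetric] sets.Int)
    also have "unit_square \<inter> X \<times> Y = (X \<inter> {0..1}) \<times> (Y \<inter> {0..1})" by auto
    also have "emeasure lborel \<dots> = emeasure lborel (X \<inter> {0..1}) * emeasure lborel (Y \<inter> {0..1})"
      unfolding lborel_prod[symmetric] using XY by (intro lborel.emeasure_pair_measure_Times) auto
    finally show "emeasure unit_law X * emeasure unit_law Y = emeasure (density lborel (indicator unit_square)) (X \<times> Y)"
      by (simp only: law XY)
  qed (rule L.sigma_finite_measure_axioms)+
  then show ?thesis by (simp add: square_law_eq)
qed

text \<open>Completion does not change which properties hold almost everywhere, so definiteness in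
  \<open>norm_on\<close> can be tested with \<open>square_law\<close>.\<close>

lemma AE_unit_square_iff: "(AE p in lebesgue_on unit_square. P p) \<longleftrightarrow> (AE p in square_law. P p)"
proof -
  have S: "unit_square \<in> sets lborel" by (simp add: borel_Times)
  have "(AE p in lebesgue_on unit_square. P p) \<longleftrightarrow> (AE p in lebesgue. p \<in> unit_square \<longrightarrow> P p)"
    using S by (intro AE_restrict_space_iff) auto
  also have "\<dots> \<longleftrightarrow> (AE p in lborel. p \<in> unit_square \<longrightarrow> P p)"
    by (rule AE_completion_iff)
  also have "\<dots> \<longleftrightarrow> (AE p in square_law. P p)"
    unfolding square_law_eq_density using S by (subst AE_density) (auto simp: indicator_def)
  finally show ?thesis .
qed

text \<open>A Lebesgue measurable function has a Borel representative; truncating it at a bound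
  \<open>C\<close> of \<open>f\<close> makes it bounded everywhere and keeps its values where it
  agrees with \<open>f\<close> on the square.\<close>

lemma F_real_borel_modification:
  assumes f: "f \<in> F_real"
  obtains g where "g \<in> bounded_borel" "AE p in square_law. f p = g p"
proof -
  have S: "unit_square \<in> sets lebesgue" by (simp add: borel_Times)
  obtain C where C: "\<And>p. p \<in> unit_square \<Longrightarrow> \<bar>f p\<bar> \<le> C"
    using f by (auto simp: F_real_def bounded_iff)
  have "(\<lambda>p. if p \<in> unit_square then f p else 0) \<in> borel_measurable lebesgue"
    using f by (intro borel_measurable_if_I S) (simp add: F_real_def)
  from completion_ex_borel_measurable_real[OF this] obtain g where
    g: "g \<in> borel_measurable lborel" "AE p in lborel. (if p \<in> unit_square then f p else 0) = g p"
    by auto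
  define h where "h p = max (- C) (min C (g p))" for p
  have "\<bar>h p\<bar> \<le> \<bar>C\<bar>" for p by (simp add: h_def max_def min_def) arith
  moreover have "h \<in> borel_measurable borel" unfolding h_def using g(1) by measurable
  ultimately have "h \<in> bounded_borel" by (auto simp: bounded_borel_def)
  moreover have "AE p in square_law. f p = h p"
    unfolding square_law_eq_density
  proof (subst AE_density)
    show "AE p in lborel. 0 < (indicator unit_square p :: ennreal) \<longrightarrow> f p = h p"
      using g(2)
    proof eventually_elim
      case (elim p)
      show ?case
      proof
        assume "0 < (indicator unit_square p :: ennreal)"
        then have p: "p \<in> unit_square" by (rule contrapos_pp) simp
        then have "f p = g p" using elim by simp
        then show "f p = h p" using C[OF p] by (simp add: h_def abs_le_iff)
      qed
    qed
  qed (rule borel_measurable_indicator, simp add: borel_Times)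
  ultimately show ?thesis using that by blast
qed

lemma bounded_borel_F_real: "f \<in> bounded_borel \<Longrightarrow> f \<in> F_real"
  by (auto simp: bounded_borel_def F_real_def bounded_iff intro!: measurable_restrict_space1 measurable_completion)

text \<open>In the completion, \<open>f\<close> inherits measurability from \<open>g\<close> because
  they differ only on a null set.\<close>

lemma integral_completion_AE:
  fixes f g :: "'a \<Rightarrow> real"
  assumes g: "g \<in> borel_measurable M" and ae: "AE x in M. f x = g x"
  shows "integral\<^sup>L (completion M) f = integral\<^sup>L M g"
proof -
  have g': "g \<in> borel_measurable (completion M)" using g by (rule measurable_completion)
  have ae': "AE x in completion M. f x = g x" using ae by (rule AE_completion)
  have f: "f \<in> borel_measurable (completion M)"
  proof (rule measurableI)
    fix X :: "real set" assume "X \<in> sets borel"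
    then have "g -` X \<inter> space (completion M) \<in> sets (completion M)" using g' by (rule measurable_sets[rotated])
    then show "f -` X \<inter> space (completion M) \<in> sets (completion M)"
      by (rule completion.in_sets_AE[rotated]) (use ae' in \<open>auto elim: eventually_mono\<close>)
  qed simp
  show ?thesis
    using integral_cong_AE[OF f g' ae'] integral_completion[OF g] by simp
qed

section \<open>A common interface for the two functionals\<close>

definition modulus :: "bool \<Rightarrow> real \<Rightarrow> real" where
  "modulus s x = (if s then \<bar>x\<bar> else x)"

lemma kernel_class_modulus: "f \<in> bounded_borel \<Longrightarrow> (\<lambda>p. modulus s (f p)) \<in> kernel_class s"
  by (cases s) (auto simp: kernel_class_def modulus_def bounded_borel_abs)

lemma modulus_kernel_class: "f \<in> kernel_class s \<Longrightarrow> (\<lambda>p. modulus s (f p)) = f"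
  by (auto simp: kernel_class_def modulus_def)

text \<open>\<open>N\<close> acts on Borel kernels and \<open>N'\<close> on arbitrary functions;
  \<open>transfer\<close> links them through Borel representatives. \<open>mono\<close> serves the
  weakly norming case, where \<open>modulus\<close> is only subadditive.\<close>

locale kernel_functional =
  fixes N N' :: "(real \<times> real \<Rightarrow> real) \<Rightarrow> real"
  assumes transfer: "\<And>f g. g \<in> bounded_borel \<Longrightarrow> AE p in square_law. f p = g p \<Longrightarrow> N' f = N g"
    and nonneg: "\<And>g. 0 \<le> N g"
    and cmult: "\<And>c g. N (\<lambda>p. c * g p) = \<bar>c\<bar> * N g"
    and mono: "\<And>f g. f \<in> bounded_borel \<Longrightarrow> g \<in> bounded_borel \<Longrightarrow> (\<And>p. 0 \<le> f p) \<Longrightarrow> (\<And>p. f p \<le> g p) \<Longrightarrow> N f \<le> N g"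
begin

lemma norm_on_imp:
  assumes norm: "norm_on T (\<lambda>f. N' (\<lambda>p. modulus s (f p)))" and S: "S \<subseteq> kernel_class s" "S \<subseteq> T"
  shows "subadditive_on S N" "definite_on S N"
proof -
  have eq: "N' (\<lambda>p. modulus s (f p)) = N f" if "f \<in> kernel_class s" for f
    using that by (simp add: modulus_kernel_class transfer kernel_class_bounded_borel)
  show "subadditive_on S N"
    unfolding subadditive_on_def
  proof (intro ballI)
    fix f g assume fg: "f \<in> S" "g \<in> S"
    then have "f \<in> kernel_class s" "g \<in> kernel_class s" "(\<lambda>p. f p + g p) \<in> kernel_class s"
      using S by (auto intro: kernel_class_intros)
    note this[THEN eq]
    moreover have "N' (\<lambda>p. modulus s (f p + g p)) \<le> N' (\<lambda>p. modulus s (f p)) + N' (\<lambda>p. modulus s (g p))"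
      using norm subsetD[OF S(2) fg(1)] subsetD[OF S(2) fg(2)]
      unfolding norm_on_def seminorm_on_def by blast
    ultimately show "N (\<lambda>p. f p + g p) \<le> N f + N g" by simp
  qed
  show "definite_on S N"
    using norm S eq unfolding norm_on_def definite_on_def AE_unit_square_iff by (metis subsetD)
qed

lemma norm_on_F_realI:
  assumes sub: "subadditive_on (kernel_class s) N" and def: "definite_on (kernel_class s) N"
  shows "norm_on F_real (\<lambda>f. N' (\<lambda>p. modulus s (f p)))"
  unfolding norm_on_def seminorm_on_def
proof (intro conjI ballI allI impI)
  have eq: "N' (\<lambda>p. modulus s (f p)) = N (\<lambda>p. modulus s (f' p))"
    if "f' \<in> bounded_borel" "AE p in square_law. f p = f' p" for f f'
    by (rule transfer[OF kernel_class_bounded_borel[OF kernel_class_modulus[OF that(1)]]])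
       (use that(2) in \<open>auto elim: eventually_mono\<close>)
  fix f assume "f \<in> F_real"
  then obtain f' where f': "f' \<in> bounded_borel" "AE p in square_law. f p = f' p"
    by (rule F_real_borel_modification)
  let ?f = "\<lambda>p. modulus s (f' p)"
  show "0 \<le> N' (\<lambda>p. modulus s (f p))"
    using eq[OF f'] nonneg by simp
  show "N' (\<lambda>p. modulus s (c * f p)) = \<bar>c\<bar> * N' (\<lambda>p. modulus s (f p))" for c
  proof -
    have "N' (\<lambda>p. modulus s (c * f p)) = N (\<lambda>p. modulus s (c * f' p))"
      using f' by (intro eq bounded_borel_cmult) (auto elim: eventually_mono)
    also have "(\<lambda>p. modulus s (c * f' p)) = (\<lambda>p. modulus s c * modulus s (f' p))"
      by (simp add: modulus_def abs_mult)
    also have "N \<dots> = \<bar>c\<bar> * N ?f" unfolding cmult by (simp add: modulus_def)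
    finally show ?thesis using eq[OF f'] by simp
  qed
  show "N' (\<lambda>p. modulus s (f p + g p)) \<le> N' (\<lambda>p. modulus s (f p)) + N' (\<lambda>p. modulus s (g p))"
    if "g \<in> F_real" for g
  proof -
    obtain g' where g': "g' \<in> bounded_borel" "AE p in square_law. g p = g' p"
      using \<open>g \<in> F_real\<close> by (rule F_real_borel_modification)
    let ?g = "\<lambda>p. modulus s (g' p)"
    have fg: "(\<lambda>p. f' p + g' p) \<in> bounded_borel" using f' g' by (simp add: bounded_borel_add)
    have "N' (\<lambda>p. modulus s (f p + g p)) = N (\<lambda>p. modulus s (f' p + g' p))"
    proof (rule eq[OF fg])
      show "AE p in square_law. f p + g p = f' p + g' p"
        using f'(2) g'(2) by eventually_elim simp
    qed
    \<comment> \<open>For absolute values the pointwise triangle inequality is combined with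
      monotonicity; without them the two sides coincide.\<close>
    also have "\<dots> \<le> N (\<lambda>p. ?f p + ?g p)"
    proof (cases s)
      case True
      then show ?thesis
        using f' g' fg by (intro mono) (auto simp: modulus_def intro: bounded_borel_abs bounded_borel_add)
    qed (simp add: modulus_def)
    also have "\<dots> \<le> N ?f + N ?g"
      using f' g' by (intro subadditive_onD[OF sub] kernel_class_modulus)
    finally show ?thesis using eq[OF f'] eq[OF g'] by simp
  qed
  show "AE p in lebesgue_on unit_square. f p = 0" if "N' (\<lambda>p. modulus s (f p)) = 0"
    unfolding AE_unit_square_iff
  proof -
    have "AE p in square_law. modulus s (f' p) = 0"
      using that eq[OF f'] f' by (intro definite_onD[OF def] kernel_class_modulus) auto
    with f'(2) show "AE p in square_law. f p = 0"
      by eventually_elim (auto simp: modulus_def split: if_splits)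
  qed
qed

end

section \<open>Identification with \<open>t_H\<close> and \<open>q_H\<close> on Lebesgue measurable
  functions\<close>

context connected_bipartite_graph
begin

text \<open>The ends of an edge are distinct, so they form a uniform pair, and \<open>f\<close> may
  be replaced by \<open>g\<close> there outside a null set; there are finitely many edges. Exponents
  0 and 1 then select a factor just as \<open>orient\<close> does.\<close>

lemma r_H_eq_hom:
  assumes g: "g \<in> bounded_borel" and ae: "AE p in square_law. f p = g p"
    and a: "\<And>e. e \<in> E \<Longrightarrow> a e \<in> {0, 1}"
  shows "r_H A B E a f = hom (\<lambda>e. orient (a e) g)"
proof -
  have pair: "AE z in cube V. f (z u, z v) = g (z u, z v)" if uv: "u \<in> V" "v \<in> V" "u \<noteq> v" for u v
  proof -
    have "(\<lambda>z. (z u, z v)) \<in> borel_measurable (cube V)"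
      using measurable_Pair[OF coordinate_measurable coordinate_measurable, OF finite_V V_ne _ finite_V V_ne] uv
      by (simp add: borel_prod)
    then show ?thesis
      by (rule AE_distrD) (use ae in \<open>simp only: distr_cube_pair[OF finite_V V_ne uv]\<close>)
  qed
  have "AE z in cube V. \<forall>e\<in>E. f (z (fst e), z (snd e)) = g (z (fst e), z (snd e)) \<and>
      f (z (snd e), z (fst e)) = g (z (snd e), z (fst e))"
    using edge_V edge_neq edge_neq[symmetric] by (intro AE_finite_allI[OF finite_E] AE_conjI pair)
  then have "AE z in cube V.
      (\<Prod>(u, v)\<in>E. f (z u, z v) ^ a (u, v) * f (z v, z u) ^ (1 - a (u, v)))
      = (\<Prod>e\<in>E. orient (a e) g (z (fst e), z (snd e)))"
  proof eventually_elim
    case (elim z)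
    show ?case
    proof (rule prod.cong[OF refl])
      fix e assume e: "e \<in> E"
      obtain u v where uv: "e = (u, v)" by (cases e)
      show "(case e of (u, v) \<Rightarrow> f (z u, z v) ^ a (u, v) * f (z v, z u) ^ (1 - a (u, v)))
        = orient (a e) g (z (fst e), z (snd e))"
        using a[OF e] bspec[OF elim e] by (auto simp: uv orient_def flip_def)
    qed
  qed
  then show ?thesis
    unfolding r_H_def cube_measure_def hom_def using g
    by (intro integral_completion_AE prod_measurable) (simp_all add: bounded_borel_measurable orient_bounded_borel)
qed

lemma t_H_eq_hom:
  assumes "g \<in> bounded_borel" "AE p in square_law. f p = g p"
  shows "t_H A B E f = hom1 g"
proof -
  have "t_H A B E f = r_H A B E (\<lambda>_. 1) f" by (simp add: t_H_def r_H_def)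
  then show ?thesis using r_H_eq_hom[OF assms, of "\<lambda>_. 1"] by (simp add: orient_def)
qed

lemma q_H_eq_orient_max:
  assumes "g \<in> bounded_borel" "AE p in square_law. f p = g p"
  shows "q_H A B E f = orient_max g"
proof -
  have "r_H A B E a f = hom (\<lambda>e. orient (a e) g)" if "a \<in> E \<rightarrow>\<^sub>E {0, 1}" for a
    using r_H_eq_hom[OF assms] PiE_mem[OF that] by blast
  then show ?thesis unfolding q_H_def orient_max_def by (simp cong: image_cong_simp)
qed

lemma root_hom_mono:
  assumes "f \<in> bounded_borel" "g \<in> bounded_borel" "\<And>p. 0 \<le> f p" "\<And>p. f p \<le> g p"
  shows "root_hom f \<le> root_hom g"
proof -
  have "0 \<le> hom1 f" using assms by (intro hom_nonneg) auto
  moreover have "hom1 f \<le> hom1 g" using assms by (intro hom_mono) auto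
  ultimately show ?thesis unfolding root_hom_def by (intro powr_mono2) auto
qed

lemma root_orient_max_mono:
  assumes "f \<in> bounded_borel" "g \<in> bounded_borel" "\<And>p. 0 \<le> f p" "\<And>p. f p \<le> g p"
  shows "root_orient_max f \<le> root_orient_max g"
proof -
  have "orient_max f \<le> orient_max g"
  proof (rule orient_max_le)
    fix a :: "'v \<times> 'v \<Rightarrow> nat" assume a: "a \<in> E \<rightarrow>\<^sub>E {0, 1}"
    have *: "0 \<le> orient b f p" "orient b f p \<le> orient b g p" for b p
      using assms(3,4) by (auto simp: orient_def flip_def)
    have "0 \<le> hom (\<lambda>e. orient (a e) f)" using * by (intro hom_nonneg)
    moreover have "hom (\<lambda>e. orient (a e) f) \<le> hom (\<lambda>e. orient (a e) g)"
      using * assms(1,2) by (intro hom_mono orient_bounded_borel)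
    ultimately have "\<bar>hom (\<lambda>e. orient (a e) f)\<bar> \<le> \<bar>hom (\<lambda>e. orient (a e) g)\<bar>" by simp
    also have "\<dots> \<le> orient_max g" by (rule abs_hom_le_orient_max[OF a])
    finally show "\<bar>hom (\<lambda>e. orient (a e) f)\<bar> \<le> orient_max g" .
  qed
  then show ?thesis unfolding root_orient_max_def using orient_max_nonneg by (intro powr_mono2) auto
qed

lemma root_orient_max_cmult: "root_orient_max (\<lambda>p. c * f p) = \<bar>c\<bar> * root_orient_max f"
proof -
  have "\<bar>hom (\<lambda>e. orient (a e) (\<lambda>p. c * f p))\<bar> = \<bar>c\<bar> ^ m * \<bar>hom (\<lambda>e. orient (a e) f)\<bar>" for a
    using hom_cmult[of "\<lambda>_. c" "\<lambda>e. orient (a e) f"] by (simp add: orient_cmult abs_mult power_abs)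
  then have "orient_max (\<lambda>p. c * f p) = Max ((*) (\<bar>c\<bar> ^ m) ` (\<lambda>a. \<bar>hom (\<lambda>e. orient (a e) f)\<bar>) ` (E \<rightarrow>\<^sub>E {0, 1}))"
    unfolding orient_max_def image_image by simp
  also have "\<dots> = \<bar>c\<bar> ^ m * orient_max f"
    unfolding orient_max_def using finite_orientations orientations_ne
    by (intro mono_Max_commute[symmetric]) (auto simp: mono_def mult_left_mono)
  finally have "orient_max (\<lambda>p. c * f p) = \<bar>c\<bar> ^ m * orient_max f" .
  then show ?thesis
    using orient_max_nonneg[of f] by (simp add: root_orient_max_def powr_mult root_m_of_power)
qed

lemma t_H_transfer:
  assumes "g \<in> bounded_borel" "AE p in square_law. f p = g p"
  shows "\<bar>t_H A B E f\<bar> powr (1 / real m) = root_hom g"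
  using t_H_eq_hom[OF assms] by (simp add: root_hom_def)

lemma q_H_transfer:
  assumes "g \<in> bounded_borel" "AE p in square_law. f p = g p"
  shows "q_H A B E f powr (1 / real m) = root_orient_max g"
  using q_H_eq_orient_max[OF assms] by (simp add: root_orient_max_def)

lemma root_orient_max_nonneg: "0 \<le> root_orient_max f"
  by (simp add: root_orient_max_def)

sublocale root_hom: kernel_functional root_hom "\<lambda>f. \<bar>t_H A B E f\<bar> powr (1 / real m)"
  by unfold_locales (fact t_H_transfer root_hom_nonneg root_hom_cmult root_hom_mono)+

sublocale root_orient_max: kernel_functional root_orient_max "\<lambda>f. q_H A B E f powr (1 / real m)"
  by unfold_locales (fact q_H_transfer root_orient_max_nonneg root_orient_max_cmult root_orient_max_mono)+

text \<open>A cycle of implications from symmetric \<open>t\<close> to \<open>q\<close>, from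
  \<open>q\<close> to \<open>t\<close>, and back by restriction to a subspace. The first two pass
  through Borel kernels.\<close>

lemma norming_equivalence:
  fixes s :: bool
  defines "t \<equiv> \<lambda>f. \<bar>t_H A B E (\<lambda>p. modulus s (f p))\<bar> powr (1 / real m)"
    and "q \<equiv> \<lambda>f. q_H A B E (\<lambda>p. modulus s (f p)) powr (1 / real m)"
  shows "(norm_on F_real_sym t \<longleftrightarrow> norm_on F_real q) \<and> (norm_on F_real q \<longleftrightarrow> norm_on F_real t)"
proof -
  have "norm_on F_real q" if "norm_on F_real_sym t"
  proof -
    have "sym_kernel_class s \<subseteq> kernel_class s" "sym_kernel_class s \<subseteq> F_real_sym"
      by (auto simp: sym_kernel_class_def F_real_sym_def flip_def fun_eq_iff
          intro: bounded_borel_F_real kernel_class_bounded_borel)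
    from root_hom.norm_on_imp[OF that[unfolded t_def] this] show ?thesis
      unfolding q_def by (intro root_orient_max.norm_on_F_realI root_orient_max_subadditive root_orient_max_definite)
  qed
  moreover have "norm_on F_real t" if "norm_on F_real q"
  proof -
    have "kernel_class s \<subseteq> F_real" by (auto intro: bounded_borel_F_real kernel_class_bounded_borel)
    from root_orient_max.norm_on_imp[OF that[unfolded q_def] order_refl this] show ?thesis
      unfolding t_def by (intro root_hom.norm_on_F_realI root_hom_subadditive root_max_hom_subadditive root_hom_definite)
  qed
  moreover have "norm_on F_real_sym t" if "norm_on F_real t"
    using that by (auto simp: norm_on_def seminorm_on_def F_real_sym_def)
  ultimately show ?thesis by blast
qed

text \<open>This reconciles \<open>weakly_norming\<close>, which has no outer absolute value, with
  the form used in \<open>norming_equivalence\<close>.\<close>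

lemma t_H_abs: "\<bar>t_H A B E (\<lambda>p. \<bar>f p\<bar>)\<bar> = t_H A B E (\<lambda>p. \<bar>f p\<bar>)"
  unfolding t_H_def by (intro abs_of_nonneg integral_nonneg_AE AE_I2 prod_nonneg) auto

end

theorem theorem3p2:
  fixes A B :: "'v set" and E :: "('v \<times> 'v) set"
  assumes "bipartite_graph A B E"
    and "no_isolated_vertices A B E"
    and "connected_graph A B E"
  shows "((real_norming A B E F_real_sym \<longleftrightarrow>
             norm_on F_real (\<lambda>f. q_H A B E f powr (1 / real (card E)))) \<and>
          (norm_on F_real (\<lambda>f. q_H A B E f powr (1 / real (card E))) \<longleftrightarrow>
             real_norming A B E F_real)) \<and>
         ((weakly_norming A B E F_real_sym \<longleftrightarrow>
             norm_on F_real (\<lambda>f. q_H A B E (\<lambda>p. \<bar>f p\<bar>) powr (1 / real (card E)))) \<and>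
          (norm_on F_real (\<lambda>f. q_H A B E (\<lambda>p. \<bar>f p\<bar>) powr (1 / real (card E))) \<longleftrightarrow>
             weakly_norming A B E F_real))"
proof -
  interpret connected_bipartite_graph A B E by unfold_locales (fact assms)+
  show ?thesis
    \<comment> \<open>The flag \<open>False\<close> yields the real-norming equivalences,
      \<open>True\<close> the weakly norming ones.\<close>
    using norming_equivalence[of False] norming_equivalence[of True]
    unfolding real_norming_def weakly_norming_def by (simp add: modulus_def t_H_abs)
qed

end
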